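(* Let $q=p^m$ with $p$ prime and let $(k,q)$ be a semiprimitive pair. Then the graph $\Gamma=\Gamma(k,p^m)$ is Ramanujan if and only if $\Gamma^+=\Gamma^+(k,p^m)$ is Ramanujan, and this happens if and only if (a) $\Gamma$ is the classic Paley graph $\Gamma(2,q)$, with $q\equiv1\pmod4$, or $m$ is even and $k,p,m$ are as in one of the following cases: (b) $k=3$, $p=2$ and $m\ge4$; (c) $k=3$, $p\ne2$ with $p\equiv2\pmod3$ and $m\ge2$; (d) $k=4$, $p=3$ and $m\ge4$; (e) $k=4$, $p\ne3$ with $p\equiv3\pmod4$ and $m\ge2$; (f) $k=5$, $p=2$ and $m\ge8$ with $4\mid m$; (g) $k=5$, $p\ne2$ with $p\equiv2,3\pmod5$ and $m\ge4$ with $4\mid m$; (h) $k=5$, $p\equiv4\pmod5$ and $m\ge2$ even. Moreover, $\bar\Gamma(k,q)$ is Ramanujan for every semiprimitive pair $(k,q)$.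
   Context: Let $p$ be prime, $q=p^m$ and $k\mid q-1$. Put $R_k=\{x^k:x\in\mathbb{F}_q^*\}$. The generalized Paley graph $\Gamma(k,q)$ has vertex set $\mathbb{F}_q$ with $u,v$ adjacent iff $v-u\in R_k$; the sum graph $\Gamma^+(k,q)$ has vertex set $\mathbb{F}_q$ with $u,v$ adjacent iff $u+v\in R_k$ (with a loop at $x$ if $x+x\in R_k$); $\bar\Gamma(k,q)$ is the complement of $\Gamma(k,q)$. $(k,q)$ is a semiprimitive pair if either $k=2$ and $q\equiv1\pmod4$, or $k>2$, $k\mid p^{t}+1$ for some positive integer $t\mid\frac m2$ (with $m$ even), and $k\ne p^{\frac m2}+1$. A connected $n$-regular undirected graph $G$ (possibly with loops) is Ramanujan if $\lambda(G)\le2\sqrt{n-1}$, where $\lambda(G)=\max\{|\lambda|:\lambda\in\mathrm{Spec}(G),\ |\lambda|\ne n\}$ and $\mathrm{Spec}(G)$ is the set of eigenvalues of the adjacency matrix. *)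

theory Defs
  imports "HOL-Analysis.Analysis" "HOL-Computational_Algebra.Computational_Algebra"
begin

text \<open>
  An undirected graph, possibly with loops, is a symmetric edge relation on a finite
  type, all of whose elements are the vertices; a loop at \<open>x\<close> is the pair \<open>(x, x)\<close>.
\<close>

definition graph_connected :: "'v rel \<Rightarrow> bool" where
  "graph_connected E \<longleftrightarrow> (\<forall>u v. (u, v) \<in> E\<^sup>*)"

text \<open>A loop contributes 1 to the degree, in accordance with the row sums of the adjacency matrix.\<close>

definition graph_regular :: "'v::finite rel \<Rightarrow> nat \<Rightarrow> bool" where
  "graph_regular E n \<longleftrightarrow> (\<forall>v. card (E `` {v}) = n)"

definition graph_complement :: "'v rel \<Rightarrow> 'v rel" where
  "graph_complement E = {(u, v). u \<noteq> v \<and> (u, v) \<notin> E}"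

definition adjacency_matrix :: "'v::finite rel \<Rightarrow> complex ^ 'v ^ 'v" where
  "adjacency_matrix E = (\<chi> u v. if (u, v) \<in> E then 1 else 0)"

definition graph_spectrum :: "'v::finite rel \<Rightarrow> complex set" where
  "graph_spectrum E = {l. \<exists>x. x \<noteq> 0 \<and> adjacency_matrix E *v x = l *s x}"

text \<open>
  The parameter \<open>n\<close> is the degree of the graph. The value is meaningful only if some
  eigenvalue has absolute value different from \<open>n\<close>.
\<close>

definition graph_lambda :: "'v::finite rel \<Rightarrow> nat \<Rightarrow> real" where
  "graph_lambda E n = Max {cmod l | l. l \<in> graph_spectrum E \<and> cmod l \<noteq> real n}"

definition ramanujan :: "'v::finite rel \<Rightarrow> bool" where
  "ramanujan E \<longleftrightarrow> sym E \<and> graph_connected E \<and>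
     (\<exists>n. graph_regular E n \<and> graph_lambda E n \<le> 2 * sqrt (real n - 1))"

definition power_residues :: "nat \<Rightarrow> 'a::field set" where
  "power_residues k = {x ^ k | x. x \<noteq> 0}"

definition gen_paley :: "nat \<Rightarrow> 'a::field rel" where
  "gen_paley k = {(u, v). v - u \<in> power_residues k}"

definition gen_paley_sum :: "nat \<Rightarrow> 'a::field rel" where
  "gen_paley_sum k = {(u, v). u + v \<in> power_residues k}"

definition semiprimitive_pair :: "nat \<Rightarrow> nat \<Rightarrow> nat \<Rightarrow> bool" where
  "semiprimitive_pair k p m \<longleftrightarrow>
     (k = 2 \<and> p ^ m mod 4 = 1) \<or>
     (k > 2 \<and> even m \<and> (\<exists>t>0. t dvd m div 2 \<and> k dvd p ^ t + 1) \<and> k \<noteq> p ^ (m div 2) + 1)"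

end

theory Submission
  imports Defs "HOL-Number_Theory.Cong"
begin

text \<open>
  Let \<open>R\<close> be the group of nonzero \<open>k\<close>-th powers, \<open>n = (q - 1) / k\<close> its order, and \<open>\<psi>\<close> a
  nontrivial additive character. The Fourier transform shows that the adjacency matrices of the
  Cayley graph and of the Cayley sum graph of \<open>R = - R\<close> have the same absolute eigenvalues, namely
  \<open>n\<close> and the Gaussian periods \<open>\<bar>\<eta>\<^sub>a\<bar>\<close> with \<open>\<eta>\<^sub>a = (\<Sum>r\<in>R. \<psi> (a * r))\<close>, \<open>a \<noteq> 0\<close>. If all these
  periods are smaller than \<open>n\<close>, each of the two graphs is Ramanujan exactly if
  \<open>\<bar>\<eta>\<^sub>a\<bar> \<le> 2 * sqrt (n - 1)\<close> for all \<open>a \<noteq> 0\<close> (\<open>ramanujan_cayley_iff\<close>). The complement is a Cayley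
  graph as well, with nontrivial eigenvalues \<open>- 1 - \<eta>\<^sub>a\<close>.

  The sums \<open>S\<^sub>a = 1 + k * \<eta>\<^sub>a = (\<Sum>x. \<psi> (a * x ^ k))\<close> are real and constant on cosets of \<open>R\<close>,
  their sum over \<open>a \<noteq> 0\<close> is \<open>0\<close>, and the sum of their squares is \<open>(q - 1) * q * (k - 1)\<close>. By the
  Cauchy-Schwarz inequality this alone gives \<open>\<bar>S\<^sub>a\<bar> \<le> (k - 1) * sqrt q\<close> (\<open>power_sum_bound\<close>), which
  suffices for all positive assertions: that the complement is Ramanujan, and that both graphs are
  Ramanujan for \<open>k \<le> 5\<close>.

  For \<open>k > 2\<close> the bound is attained (\<open>power_sum_extremal\<close>). The group \<open>R\<close> contains the
  multiplicative group of the prime field, so the \<open>\<eta>\<^sub>a\<close> are integers. As \<open>k\<close> divides \<open>p ^ t + 1\<close>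
  and \<open>x ^ (p ^ t + 1)\<close> behaves like a Hermitian form, the integers \<open>S\<^sub>a\<close> are divisible by
  \<open>h = sqrt q\<close>, which is congruent to \<open>1\<close> or \<open>- 1\<close> modulo \<open>k\<close>. The quotients \<open>S\<^sub>a / h\<close> then
  lie in one residue class \<open>\<delta> = \<plusminus>1\<close> modulo \<open>k\<close>, and the two moments leave only the values
  \<open>\<delta>\<close> and \<open>\<delta> * (1 - k)\<close>. The second value must occur because the first
  moment is \<open>0\<close>. Hence some \<open>\<bar>\<eta>\<^sub>a\<bar>\<close> is at least \<open>((k - 1) * h - 1) / k\<close>, which exceeds
  \<open>2 * sqrt (n - 1)\<close> for \<open>k \<ge> 6\<close>. So being Ramanujan means \<open>k \<le> 5\<close>, and the listed cases are the
  semiprimitive pairs with \<open>k \<le> 5\<close>.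
\<close>

(* The infix $ below denotes the components of vectors, not the coefficients of power series. *)
no_notation fps_nth (infixl \<open>$\<close> 75)

section \<open>Additive characters of a finite field\<close>

lemma finite_field_CHAR:
  assumes "prime p" and "CARD('a::finite_field) = p ^ m"
  shows "CHAR('a) = p"
proof -
  have "(\<Sum>x\<in>(UNIV::'a set). x + 1) = (\<Sum>x\<in>(UNIV::'a set). x)"
    by (rule sum.reindex_bij_witness[of _ "\<lambda>x. x - 1" "\<lambda>x. x + 1"]) auto
  hence "of_nat CARD('a) = (0::'a)"
    by (simp add: sum.distrib)
  hence "CHAR('a) dvd p ^ m"
    using assms(2) of_nat_eq_0_iff_char_dvd by metis
  moreover have "prime CHAR('a)" by simp
  ultimately show ?thesis
    using assms(1) by (metis prime_dvd_power primes_dvd_imp_eq)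
qed

lemma power_eq_power_mod:
  fixes w :: "'a::monoid_mult"
  assumes "w ^ p = 1"
  shows "w ^ i = w ^ (i mod p)"
proof -
  have "w ^ i = w ^ (p * (i div p) + i mod p)" by simp
  thus ?thesis unfolding power_add power_mult assms by simp
qed

lemma prime_field_power_CHAR: "of_nat j ^ CHAR('a) = (of_nat j :: 'a::finite_field)"
proof (induction j)
  case 0
  show ?case by simp
next
  case (Suc j)
  have "(1 + of_nat j :: 'a) ^ CHAR('a) = 1 ^ CHAR('a) + of_nat j ^ CHAR('a)"
    by (rule freshmans_dream) simp_all
  then show ?case using Suc by simp
qed

lemma of_nat_CHAR_inj:
  "inj_on (of_nat :: nat \<Rightarrow> 'a::finite_field) {..<CHAR('a)}"
proof (rule inj_onI)
  fix i j :: nat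
  assume ij: "i \<in> {..<CHAR('a)}" "j \<in> {..<CHAR('a)}" "of_nat i = (of_nat j :: 'a)"
  have "i = j" if "i \<le> j" "j < CHAR('a)" "of_nat i = (of_nat j :: 'a)" for i j
  proof -
    have "of_nat (j - i) = (0::'a)" using that by (simp add: of_nat_diff)
    hence "CHAR('a) dvd j - i" using of_nat_eq_0_iff_char_dvd by blast
    hence "\<not> 0 < j - i" using dvd_imp_le[of "CHAR('a)" "j - i"] that by linarith
    thus ?thesis using that by simp
  qed
  thus "i = j" using ij by (metis lessThan_iff nat_le_linear)
qed

lemma finite_field_fixed_CHAR:
  assumes "x ^ CHAR('a) = (x::'a::finite_field)"
  shows "\<exists>j. x = of_nat j"
proof -
  define p where "p = CHAR('a)"
  have p: "prime p" by (simp add: p_def)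
  define P where "P = monom 1 p - [:0, 1 :: 'a:]"
  have dP: "degree P = p"
    unfolding P_def using prime_gt_1_nat[OF p]
    by (subst diff_conv_add_uminus, subst degree_add_eq_left) (auto simp: degree_monom_eq)
  hence P0: "P \<noteq> 0" using prime_gt_0_nat[OF p] by auto
  have eq: "{x. poly P x = 0} = {x. x ^ p = x}"
    by (auto simp: P_def poly_monom)
  have "of_nat ` {..<p} = {x::'a. x ^ p = x}"
  proof (rule card_seteq)
    show "of_nat ` {..<p} \<subseteq> {x::'a. x ^ p = x}"
      using prime_field_power_CHAR by (auto simp: p_def)
    have "card {x::'a. x ^ p = x} \<le> p"
      using card_poly_roots_bound[OF P0] eq dP by simp
    also have "p = card (of_nat ` {..<p} :: 'a set)"
      using of_nat_CHAR_inj[where 'a='a] by (simp add: card_image p_def)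
    finally show "card {x::'a. x ^ p = x} \<le> card (of_nat ` {..<p} :: 'a set)" .
  qed simp
  thus ?thesis using assms by (auto simp: p_def)
qed

text \<open>
  A nontrivial character of the additive group of a finite field. The other additive characters
  are the maps \<open>\<lambda>x. \<psi> (a * x)\<close>.
\<close>
locale additive_character =
  fixes \<psi> :: "'a::finite_field \<Rightarrow> complex"
  assumes add: "\<psi> (x + y) = \<psi> x * \<psi> y"
    and zero [simp]: "\<psi> 0 = 1"
    and nontrivial: "\<exists>x. \<psi> x \<noteq> 1"

text \<open>
  The character is built from the absolute trace \<open>x + x\<^sup>p + \<dots> + x ^ (p ^ (m - 1))\<close>, which
  takes values in the prime field and, having degree less than \<open>p ^ m\<close>, does not vanish
  everywhere.
\<close>
lemma additive_character_exists:
  assumes p: "prime p" and card: "CARD('a::finite_field) = p ^ m"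
  shows "\<exists>\<psi> :: 'a \<Rightarrow> complex. additive_character \<psi>"
proof -
  have char: "CHAR('a) = p" by (rule finite_field_CHAR[OF p card])
  have p1: "p > 1" using p prime_gt_1_nat by blast
  have m0: "m > 0"
  proof (rule ccontr)
    assume "\<not> m > 0"
    hence "CARD('a) = 1" using card by simp
    hence "(0::'a) = 1" by (metis card_1_singletonE UNIV_I singletonD)
    thus False by simp
  qed
  define Tr where "Tr x = (\<Sum>i<m. x ^ (p ^ i))" for x :: 'a
  have Tr_add: "Tr (x + y) = Tr x + Tr y" for x y
  proof -
    have "(x + y) ^ (p ^ i) = x ^ (p ^ i) + y ^ (p ^ i)" for i
      by (rule freshmans_dream') (simp_all add: char p)
    thus ?thesis by (simp add: Tr_def sum.distrib)
  qed
  have "\<exists>j. Tr x = of_nat j" for x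
  proof (rule finite_field_fixed_CHAR)
    have "Tr x ^ p = (\<Sum>i<m. (x ^ (p ^ i)) ^ p)"
      unfolding Tr_def by (rule freshmans_dream_sum) (simp_all add: char p)
    also have "\<dots> = (\<Sum>i<m. x ^ (p ^ Suc i))"
      by (simp add: mult.commute flip: power_mult)
    also have "\<dots> + x = (\<Sum>i<Suc m. x ^ (p ^ i))"
      by (subst sum.lessThan_Suc_shift) simp
    also have "\<dots> = Tr x + x"
      using finite_field_power_card_eq_same[of x] card by (simp add: Tr_def)
    finally show "Tr x ^ CHAR('a) = Tr x" using char by simp
  qed
  then obtain \<tau> where \<tau>: "\<And>x. Tr x = of_nat (\<tau> x)" by metis
  define \<omega> where "\<omega> = cis (2 * pi / real p)"
  have \<omega>_pow: "\<omega> ^ i = cis (2 * pi * real i / real p)" for i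
    by (simp add: \<omega>_def Complex.DeMoivre mult_ac)
  have \<omega>p: "\<omega> ^ p = 1" using p1 by (simp add: \<omega>_pow)
  note \<omega>_mod = power_eq_power_mod[OF \<omega>p]
  have \<omega>_cong: "\<omega> ^ i = \<omega> ^ j" if "of_nat i = (of_nat j :: 'a)" for i j
  proof -
    have aux: "(of_nat (i mod p) :: 'a) = of_nat i" for i
    proof -
      have "(of_nat i :: 'a) = of_nat p * of_nat (i div p) + of_nat (i mod p)"
        by (metis mult_div_mod_eq of_nat_add of_nat_mult)
      thus ?thesis using of_nat_CHAR[where 'a='a] char by simp
    qed
    have "i mod p = j mod p"
      using of_nat_CHAR_inj[where 'a='a] that p1
      by (auto simp: char inj_on_def aux)
    thus ?thesis using \<omega>_mod by metis
  qed
  have inj: "inj_on (\<lambda>k. cis (2 * pi * real k / real p)) {..<p}"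
    using Complex.bij_betw_roots_unity[of p] p1 by (auto simp: bij_betw_def)
  define \<psi> where "\<psi> x = \<omega> ^ \<tau> x" for x
  have "\<exists>x. Tr x \<noteq> 0"
  proof (rule ccontr)
    assume "\<not> ?thesis"
    hence all: "Tr x = 0" for x by simp
    define P where "P = (\<Sum>i<m. monom 1 (p ^ i) :: 'a poly)"
    have "poly P x = 0" for x
      using all[of x] by (simp add: P_def Tr_def poly_sum poly_monom)
    moreover have "coeff P (p ^ 0) = (\<Sum>i<m. if i = 0 then 1 else 0)"
      unfolding P_def coeff_sum using p1
      by (intro sum.cong) (auto simp: power_inject_exp)
    hence "P \<noteq> 0" using m0 by auto
    ultimately have "p ^ m \<le> degree P"
      using card_poly_roots_bound[of P] card by simp
    also have "degree P \<le> p ^ (m - 1)"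
      unfolding P_def using p1
      by (intro degree_sum_le) (auto simp: degree_monom_eq intro!: power_increasing)
    also have "\<dots> < p ^ m" using p1 m0 by (intro power_strict_increasing) auto
    finally show False by simp
  qed
  then obtain x where x: "Tr x \<noteq> 0" by blast
  have "additive_character \<psi>"
  proof
    show "\<psi> (x + y) = \<psi> x * \<psi> y" for x y
    proof -
      have "of_nat (\<tau> (x + y)) = (of_nat (\<tau> x + \<tau> y) :: 'a)"
        using Tr_add[of x y] by (simp add: \<tau>)
      thus ?thesis using \<omega>_cong by (metis \<psi>_def power_add)
    qed
    have "Tr 0 = 0" using p1 by (auto simp: Tr_def intro!: sum.neutral)
    hence "of_nat (\<tau> 0) = (of_nat 0 :: 'a)" by (simp add: \<tau>)
    thus "\<psi> 0 = 1" using \<omega>_cong[of "\<tau> 0" 0] by (simp add: \<psi>_def)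
    have "\<psi> x \<noteq> 1"
    proof
      assume "\<psi> x = 1"
      hence "\<omega> ^ (\<tau> x mod p) = \<omega> ^ 0" using \<omega>_mod by (simp add: \<psi>_def)
      hence "\<tau> x mod p = 0"
        using inj p1 unfolding \<omega>_pow inj_on_def by auto
      hence "Tr x = 0" using \<tau> char of_nat_eq_0_iff_char_dvd[where 'a='a] by auto
      with x show False by simp
    qed
    thus "\<exists>x. \<psi> x \<noteq> 1" by blast
  qed
  thus ?thesis by blast
qed

lemma sum_character_subgroup:
  fixes f :: "'b::ab_group_add \<Rightarrow> complex"
  assumes "\<And>x y. x \<in> A \<Longrightarrow> y \<in> A \<Longrightarrow> x + y \<in> A"
    and "\<And>x. x \<in> A \<Longrightarrow> - x \<in> A"
    and "\<And>x y. x \<in> A \<Longrightarrow> y \<in> A \<Longrightarrow> f (x + y) = f x * f y"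
    and "b \<in> A" "f b \<noteq> 1"
  shows "sum f A = 0"
proof -
  have "sum f A = (\<Sum>x\<in>A. f (x + b))"
    using assms(1)[OF _ assms(4)] assms(1)[OF _ assms(2)[OF assms(4)]]
    by (intro sum.reindex_bij_witness[of _ "\<lambda>x. x + b" "\<lambda>x. x - b"]) auto
  also have "\<dots> = sum f A * f b"
    using assms(3,4) by (simp add: sum_distrib_right)
  finally show ?thesis using assms(5) by (metis mult_cancel_left1)
qed

context additive_character
begin

lemma of_nat_mult: "\<psi> (of_nat j * x) = \<psi> x ^ j"
  by (induction j) (simp_all add: algebra_simps add)

lemma power_CHAR: "\<psi> x ^ CHAR('a) = 1"
  using of_nat_mult[of "CHAR('a)" x] by simp

lemma norm [simp]: "cmod (\<psi> x) = 1"
proof -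
  have "cmod (\<psi> x) ^ CHAR('a) = 1"
    using power_CHAR[of x] by (metis norm_one norm_power)
  thus ?thesis
    using power_eq_imp_eq_base[of "cmod (\<psi> x)" "CHAR('a)" 1] by simp
qed

lemma minus: "\<psi> (- x) = cnj (\<psi> x)"
proof -
  have "\<psi> x * \<psi> (- x) = 1" using add[of x "-x"] by simp
  moreover have "\<psi> x * cnj (\<psi> x) = 1"
    by (simp add: complex_norm_square[symmetric])
  ultimately have "\<psi> x * \<psi> (- x) = \<psi> x * cnj (\<psi> x)" by simp
  moreover have "\<psi> x \<noteq> 0" using norm[of x] by force
  ultimately show ?thesis by simp
qed

lemma orthogonality: "(\<Sum>x\<in>UNIV. \<psi> (a * x)) = (if a = 0 then of_nat CARD('a) else 0)"
proof (cases "a = 0")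
  case False
  obtain b where "\<psi> b \<noteq> 1" using nontrivial by blast
  hence "\<psi> (a * (b / a)) \<noteq> 1" using False by simp
  thus ?thesis using False
    by (auto intro!: sum_character_subgroup[where b="b / a"] simp: distrib_left add)
qed simp

end

section \<open>Spectra of Cayley graphs and Cayley sum graphs\<close>

text \<open>The Cayley graph of an additive group with connection set \<open>S\<close>.\<close>
definition cayley_graph :: "'a::ab_group_add set \<Rightarrow> 'a rel" where
  "cayley_graph S = {(u, v). v - u \<in> S}"

text \<open>The Cayley sum graph; it has a loop at \<open>x\<close> if \<open>x + x \<in> S\<close>.\<close>
definition cayley_sum_graph :: "'a::ab_group_add set \<Rightarrow> 'a rel" where
  "cayley_sum_graph S = {(u, v). u + v \<in> S}"

lemma adjacency_matrix_mult:
  "(adjacency_matrix E *v x) $ u = (\<Sum>v | (u, v) \<in> E. x $ v)"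
proof -
  have "(adjacency_matrix E *v x) $ u = (\<Sum>v\<in>UNIV. if (u, v) \<in> E then x $ v else 0)"
    unfolding matrix_vector_mult_def adjacency_matrix_def
    by (auto intro!: sum.cong)
  also have "\<dots> = (\<Sum>v\<in>UNIV \<inter> {v. (u, v) \<in> E}. x $ v)"
    by (subst sum.inter_restrict) auto
  finally show ?thesis by simp
qed

lemma cayley_neighbours:
  fixes S :: "'a::{ab_group_add, finite} set" and x :: "complex ^ 'a::{ab_group_add, finite}"
  shows "(\<Sum>v | (u, v) \<in> cayley_graph S. x $ v) = (\<Sum>s\<in>S. x $ (s + u))"
  by (rule sum.reindex_bij_witness[of _ "\<lambda>s. s + u" "\<lambda>v. v - u"])
     (auto simp: cayley_graph_def)

lemma cayley_sum_neighbours: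
  fixes S :: "'a::{ab_group_add, finite} set" and x :: "complex ^ 'a::{ab_group_add, finite}"
  shows "(\<Sum>v | (u, v) \<in> cayley_sum_graph S. x $ v) = (\<Sum>s\<in>S. x $ (s - u))"
  by (rule sum.reindex_bij_witness[of _ "\<lambda>s. s - u" "\<lambda>v. v + u"])
     (auto simp: cayley_sum_graph_def add.commute)

lemma cayley_graph_regular:
  "graph_regular (cayley_graph (S :: 'a::{ab_group_add, finite} set)) (card S)"
proof -
  have "card (cayley_graph S `` {v}) = card S" for v
    by (rule bij_betw_same_card[of "\<lambda>w. w - v"], rule bij_betw_byWitness[where f'="\<lambda>s. s + v"])
       (auto simp: cayley_graph_def)
  thus ?thesis by (simp add: graph_regular_def)
qed

lemma cayley_sum_graph_regular:
  "graph_regular (cayley_sum_graph (S :: 'a::{ab_group_add, finite} set)) (card S)"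
proof -
  have "card (cayley_sum_graph S `` {v}) = card S" for v
    by (rule bij_betw_same_card[of "\<lambda>w. w + v"], rule bij_betw_byWitness[where f'="\<lambda>s. s - v"])
       (auto simp: cayley_sum_graph_def add.commute)
  thus ?thesis by (simp add: graph_regular_def)
qed

lemma graph_regular_unique:
  "graph_regular E n \<Longrightarrow> graph_regular E n' \<Longrightarrow> n = n'"
  by (auto simp: graph_regular_def)

text \<open>
  The indicator vector of a connected component is an eigenvector for the degree.
\<close>
lemma graph_connected_if_constant_eigenvectors:
  fixes E :: "'a::finite rel"
  assumes "sym E" and reg: "graph_regular E n"
    and const: "\<And>x u v. adjacency_matrix E *v x = of_nat n *s x \<Longrightarrow> x $ u = x $ v"
  shows "graph_connected E"
proof -
  have "(u, v) \<in> E\<^sup>*" for u v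
  proof -
    define x :: "complex ^ 'a" where "x = (\<chi> w. if (u, w) \<in> E\<^sup>* then 1 else 0)"
    have "(adjacency_matrix E *v x) $ w = (of_nat n *s x) $ w" for w
    proof -
      have "(u, z) \<in> E\<^sup>* \<longleftrightarrow> (u, w) \<in> E\<^sup>*" if "(w, z) \<in> E" for z
        using that \<open>sym E\<close> by (meson rtrancl.rtrancl_into_rtrancl symD)
      hence "(adjacency_matrix E *v x) $ w = (\<Sum>z | (w, z) \<in> E. x $ w)"
        unfolding adjacency_matrix_mult by (intro sum.cong) (auto simp: x_def)
      also have "{z. (w, z) \<in> E} = E `` {w}" by auto
      hence "(\<Sum>z | (w, z) \<in> E. x $ w) = of_nat n * x $ w"
        using reg by (simp add: graph_regular_def)
      finally show ?thesis by simp
    qed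
    hence "adjacency_matrix E *v x = of_nat n *s x" by (simp add: vec_eq_iff)
    hence "x $ u = x $ v" by (rule const)
    thus ?thesis by (auto simp: x_def split: if_splits)
  qed
  thus ?thesis by (simp add: graph_connected_def)
qed

context additive_character
begin

text \<open>
  The Fourier transform of the indicator function of \<open>S\<close>. For \<open>S\<close> the group of \<open>k\<close>-th
  powers its values at nonzero arguments are the Gaussian periods.
\<close>
definition char_sum :: "'a set \<Rightarrow> 'a \<Rightarrow> complex" where
  "char_sum S a = (\<Sum>s\<in>S. \<psi> (a * s))"

text \<open>
  The unnormalised Fourier transform of a vector indexed by the vertices.
\<close>
definition fourier :: "(complex, 'a) vec \<Rightarrow> 'a \<Rightarrow> complex" where
  "fourier x a = (\<Sum>u\<in>UNIV. x $ u * \<psi> (- (a * u)))"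

lemma fourier_scale: "fourier (l *s x) a = l * fourier x a"
  by (simp add: fourier_def sum_distrib_left mult.assoc)

lemma fourier_inversion: "(\<Sum>a\<in>UNIV. \<psi> (a * v) * fourier x a) = of_nat CARD('a) * x $ v"
proof -
  have "(\<Sum>a\<in>UNIV. \<psi> (a * v) * fourier x a)
      = (\<Sum>a\<in>UNIV. \<Sum>u\<in>UNIV. x $ u * \<psi> ((v - u) * a))"
    unfolding fourier_def sum_distrib_left
    by (intro sum.cong refl) (simp add: algebra_simps flip: add)
  also have "\<dots> = (\<Sum>u\<in>UNIV. x $ u * (\<Sum>a\<in>UNIV. \<psi> ((v - u) * a)))"
    by (subst sum.swap) (simp add: sum_distrib_left)
  also have "\<dots> = (\<Sum>u\<in>UNIV. if v = u then x $ u * of_nat CARD('a) else 0)"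
    unfolding orthogonality by (intro sum.cong) auto
  finally show ?thesis by simp
qed

lemma fourier_nonzero: "x \<noteq> 0 \<Longrightarrow> \<exists>a. fourier x a \<noteq> 0"
proof (rule ccontr)
  assume "x \<noteq> 0" "\<nexists>a. fourier x a \<noteq> 0"
  hence "of_nat CARD('a) * x $ v = 0" for v
    using fourier_inversion[of v x] by simp
  thus False using \<open>x \<noteq> 0\<close> by (simp add: vec_eq_iff)
qed

lemma constant_if_fourier_zero:
  assumes "\<And>a. a \<noteq> 0 \<Longrightarrow> fourier x a = 0"
  shows "x $ u = x $ v"
proof -
  have "of_nat CARD('a) * x $ w = fourier x 0" for w
  proof -
    have "of_nat CARD('a) * x $ w = (\<Sum>a\<in>{0}. \<psi> (a * w) * fourier x a)"
      unfolding fourier_inversion[symmetric] using assms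
      by (intro sum.mono_neutral_right) auto
    thus ?thesis by simp
  qed
  hence "of_nat CARD('a) * x $ u = of_nat CARD('a) * x $ v" by metis
  thus ?thesis by simp
qed

lemma char_sum_minus:
  assumes "uminus ` S = S"
  shows "char_sum S (- a) = char_sum S a"
proof -
  have "char_sum S (- a) = (\<Sum>s\<in>uminus ` S. \<psi> (a * s))"
    unfolding char_sum_def by (subst sum.reindex) (auto simp: inj_on_def)
  thus ?thesis using assms by (simp add: char_sum_def)
qed

lemma char_sum_real:
  assumes "uminus ` S = S"
  shows "char_sum S a \<in> \<real>"
proof -
  have "cnj (char_sum S a) = char_sum S (- a)"
    by (simp add: char_sum_def flip: minus)
  thus ?thesis using char_sum_minus[OF assms] by (simp add: Reals_cnj_iff)
qed

lemma char_sum_zero [simp]: "char_sum S 0 = of_nat (card S)"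
  by (simp add: char_sum_def)

lemma fourier_cayley:
  "fourier (adjacency_matrix (cayley_graph S) *v x) a = char_sum S a * fourier x a"
proof -
  have "fourier (adjacency_matrix (cayley_graph S) *v x) a
      = (\<Sum>s\<in>S. \<Sum>u\<in>UNIV. x $ (s + u) * \<psi> (- (a * u)))"
    unfolding fourier_def adjacency_matrix_mult cayley_neighbours sum_distrib_right
    by (rule sum.swap)
  also have "\<dots> = (\<Sum>s\<in>S. \<Sum>u\<in>UNIV. x $ u * \<psi> (- (a * (u - s))))"
  proof (rule sum.cong[OF refl])
    fix s
    show "(\<Sum>u\<in>UNIV. x $ (s + u) * \<psi> (- (a * u))) = (\<Sum>u\<in>UNIV. x $ u * \<psi> (- (a * (u - s))))"
      by (rule sum.reindex_bij_witness[of _ "\<lambda>u. u - s" "\<lambda>u. s + u"]) auto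
  qed
  also have "\<dots> = (\<Sum>s\<in>S. \<psi> (a * s) * fourier x a)"
    unfolding fourier_def sum_distrib_left
    by (intro sum.cong refl) (simp add: algebra_simps flip: add)
  finally show ?thesis by (simp add: char_sum_def sum_distrib_right)
qed

lemma fourier_cayley_sum:
  "fourier (adjacency_matrix (cayley_sum_graph S) *v x) a = char_sum S (- a) * fourier x (- a)"
proof -
  have "fourier (adjacency_matrix (cayley_sum_graph S) *v x) a
      = (\<Sum>s\<in>S. \<Sum>u\<in>UNIV. x $ (s - u) * \<psi> (- (a * u)))"
    unfolding fourier_def adjacency_matrix_mult cayley_sum_neighbours sum_distrib_right
    by (rule sum.swap)
  also have "\<dots> = (\<Sum>s\<in>S. \<Sum>u\<in>UNIV. x $ u * \<psi> (- (a * (s - u))))"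
  proof (rule sum.cong[OF refl])
    fix s
    show "(\<Sum>u\<in>UNIV. x $ (s - u) * \<psi> (- (a * u))) = (\<Sum>u\<in>UNIV. x $ u * \<psi> (- (a * (s - u))))"
      by (rule sum.reindex_bij_witness[of _ "\<lambda>u. s - u" "\<lambda>u. s - u"]) auto
  qed
  also have "\<dots> = (\<Sum>s\<in>S. \<psi> (- (a * s)) * fourier x (- a))"
    unfolding fourier_def sum_distrib_left
    by (intro sum.cong refl) (simp add: algebra_simps flip: add)
  finally show ?thesis by (simp add: char_sum_def sum_distrib_right)
qed

text \<open>
  The adjacency operator of the Cayley graph multiplies the Fourier coefficient at \<open>a\<close> by
  \<open>char_sum S a\<close>; the one of the Cayley sum graph also interchanges the coefficients at \<open>a\<close>
  and \<open>- a\<close>. If \<open>S\<close> is closed under negation, the squares of the two operators therefore agree.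
\<close>
lemma eigenvalue_fourier:
  assumes S: "uminus ` S = S" and E: "E = cayley_graph S \<or> E = cayley_sum_graph S"
    and x: "adjacency_matrix E *v x = l *s x"
  shows "l\<^sup>2 * fourier x a = (char_sum S a)\<^sup>2 * fourier x a"
  using E
proof
  assume "E = cayley_graph S"
  hence "l * fourier x a = char_sum S a * fourier x a"
    using x fourier_cayley fourier_scale by metis
  thus ?thesis by (auto simp: power2_eq_square)
next
  assume "E = cayley_sum_graph S"
  hence *: "l * fourier x b = char_sum S b * fourier x (- b)" for b
    using x fourier_cayley_sum fourier_scale char_sum_minus[OF S] by metis
  have "l\<^sup>2 * fourier x a = char_sum S a * (l * fourier x (- a))"
    using *[of a] by (simp add: power2_eq_square mult_ac)
  also have "\<dots> = (char_sum S a)\<^sup>2 * fourier x a"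
    using *[of "- a"] char_sum_minus[OF S] by (simp add: power2_eq_square)
  finally show ?thesis .
qed

text \<open>
  The even vector \<open>\<psi> (a * u) + \<psi> (- (a * u))\<close> is a common eigenvector of both graphs; it is
  nonzero in every characteristic because its value at \<open>0\<close> is the complex number \<open>2\<close>.
\<close>
lemma char_sum_eigenvalue:
  assumes S: "uminus ` S = S" and E: "E = cayley_graph S \<or> E = cayley_sum_graph S"
  shows "char_sum S a \<in> graph_spectrum E"
proof -
  define x :: "(complex, 'a) vec" where "x = (\<chi> u. \<psi> (a * u) + \<psi> (- (a * u)))"
  have sh: "(\<Sum>s\<in>S. x $ (s + u)) = char_sum S a * x $ u" for u
  proof -
    have "x $ (s + u) = \<psi> (a * s) * \<psi> (a * u) + \<psi> (- a * s) * \<psi> (- (a * u))" for s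
      by (simp add: x_def distrib_left flip: add)
    hence "(\<Sum>s\<in>S. x $ (s + u))
        = char_sum S a * \<psi> (a * u) + char_sum S (- a) * \<psi> (- (a * u))"
      by (simp add: char_sum_def sum.distrib sum_distrib_right)
    thus ?thesis using char_sum_minus[OF S] by (simp add: x_def distrib_left)
  qed
  have "x $ (s - u) = x $ (s + (- u))" "x $ (- u) = x $ u" for s u
    by (simp_all add: x_def)
  hence sh': "(\<Sum>s\<in>S. x $ (s - u)) = char_sum S a * x $ u" for u
    using sh[of "- u"] by simp
  have "(adjacency_matrix E *v x) $ u = (char_sum S a *s x) $ u" for u
    using E unfolding adjacency_matrix_mult
    by (auto simp: cayley_neighbours cayley_sum_neighbours sh sh')
  moreover have "x $ 0 = 2" by (simp add: x_def)
  hence "x \<noteq> 0" by auto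
  ultimately show ?thesis unfolding graph_spectrum_def by (auto simp: vec_eq_iff)
qed

text \<open>
  If \<open>S = - S\<close>, its Cayley graph and Cayley sum graph have the same absolute eigenvalues. As soon as
  all character sums at nonzero arguments are smaller than the degree, the degree is a simple
  eigenvalue, which gives connectedness, and it is the only eigenvalue of that absolute value.
\<close>
lemma ramanujan_cayley_iff:
  assumes S: "uminus ` S = S" and E: "E = cayley_graph S \<or> E = cayley_sum_graph S"
    and less: "\<And>a. a \<noteq> 0 \<Longrightarrow> cmod (char_sum S a) < card S"
  shows "ramanujan E \<longleftrightarrow> (\<forall>a. a \<noteq> 0 \<longrightarrow> cmod (char_sum S a) \<le> 2 * sqrt (real (card S) - 1))"
proof -
  define n where "n = card S"
  have inS: "- s \<in> S" if "s \<in> S" for s using S that by blast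
  have sym: "sym E"
    using E
  proof
    assume "E = cayley_graph S"
    thus ?thesis
      by (auto simp: sym_def cayley_graph_def) (metis inS minus_diff_eq)
  qed (auto simp: sym_def cayley_sum_graph_def add.commute)
  have reg: "graph_regular E n"
    using E cayley_graph_regular cayley_sum_graph_regular by (auto simp: n_def)
  have conn: "graph_connected E"
  proof (rule graph_connected_if_constant_eigenvectors[OF sym reg])
    fix x :: "(complex, 'a) vec" and u v
    assume x: "adjacency_matrix E *v x = of_nat n *s x"
    show "x $ u = x $ v"
    proof (rule constant_if_fourier_zero, rule ccontr)
      fix a :: 'a assume a: "a \<noteq> 0" "fourier x a \<noteq> 0"
      hence "(of_nat n)\<^sup>2 = (char_sum S a)\<^sup>2"
        using eigenvalue_fourier[OF S E x, of a] by simp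
      hence "cmod ((of_nat n)\<^sup>2) = cmod ((char_sum S a)\<^sup>2)" by simp
      hence "real n = cmod (char_sum S a)"
        by (simp add: norm_power)
      thus False using less[OF a(1)] by (simp add: n_def)
    qed
  qed
  have spec: "{cmod l | l. l \<in> graph_spectrum E \<and> cmod l \<noteq> real n}
      = (\<lambda>a. cmod (char_sum S a)) ` (UNIV - {0})" (is "?L = ?R")
  proof
    show "?R \<subseteq> ?L"
      using char_sum_eigenvalue[OF S E] less by (fastforce simp: n_def)
    show "?L \<subseteq> ?R"
    proof
      fix c assume "c \<in> ?L"
      then obtain l x where l: "c = cmod l" "c \<noteq> real n" "x \<noteq> 0"
        "adjacency_matrix E *v x = l *s x"
        by (auto simp: graph_spectrum_def)
      obtain a where a: "fourier x a \<noteq> 0" using fourier_nonzero[OF l(3)] by blast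
      hence "l\<^sup>2 = (char_sum S a)\<^sup>2"
        using eigenvalue_fourier[OF S E l(4), of a] by simp
      hence "cmod (l\<^sup>2) = cmod ((char_sum S a)\<^sup>2)" by simp
      hence c: "c = cmod (char_sum S a)" by (simp add: norm_power l(1))
      hence "a \<noteq> 0" using l(2) by (auto simp: n_def)
      thus "c \<in> ?R" using c by blast
    qed
  qed
  have "(1::'a) \<in> UNIV - {0}" by simp
  hence ne: "UNIV - {0::'a} \<noteq> {}" by blast
  have *: "graph_lambda E n \<le> b \<longleftrightarrow> (\<forall>c\<in>(\<lambda>a. cmod (char_sum S a)) ` (UNIV - {0}). c \<le> b)" for b
    unfolding graph_lambda_def spec by (rule Max_le_iff) (use ne in simp_all)
  have lambda: "graph_lambda E n \<le> b \<longleftrightarrow> (\<forall>a. a \<noteq> 0 \<longrightarrow> cmod (char_sum S a) \<le> b)" for b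
  proof -
    have "(\<forall>c\<in>(\<lambda>a. cmod (char_sum S a)) ` (UNIV - {0}). c \<le> b)
        \<longleftrightarrow> (\<forall>a. a \<noteq> 0 \<longrightarrow> cmod (char_sum S a) \<le> b)"
      by blast
    thus ?thesis unfolding * .
  qed
  have "(\<exists>n'. graph_regular E n' \<and> graph_lambda E n' \<le> 2 * sqrt (real n' - 1))
      \<longleftrightarrow> graph_lambda E n \<le> 2 * sqrt (real n - 1)"
    using reg graph_regular_unique[OF reg] by metis
  thus ?thesis
    unfolding ramanujan_def lambda using sym conn by (simp add: n_def)
qed

end

section \<open>Groups of power residues\<close>

lemma finite_field_power_card_minus_1:
  fixes x :: "'a::finite_field"
  assumes "x \<noteq> 0"
  shows "x ^ (CARD('a) - 1) = 1"
proof -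
  have "x * x ^ (CARD('a) - 1) = x ^ Suc (CARD('a) - 1)" by (rule power_Suc [symmetric])
  also have "\<dots> = x * 1"
    using finite_field_power_card_eq_same[of x] finite_UNIV_card_ge_0[where 'a='a] by simp
  finally show ?thesis using assms by simp
qed

lemma card_UNIV_minus_0: "card (UNIV - {0 :: 'a::finite_field}) = CARD('a) - 1"
  by (simp add: card_Diff_subset)

lemma CARD_finite_field_gt_1: "CARD('a::finite_field) > 1"
proof -
  have "card {0::'a, 1} \<le> CARD('a)" by (rule card_mono) auto
  thus ?thesis by simp
qed

lemma card_nth_roots_le:
  fixes c :: "'a::idom"
  assumes "n > 0"
  shows "card {x. x ^ n = c} \<le> n"
proof -
  define P where "P = monom 1 n - [:c:]"
  have d: "degree P = n"
    unfolding P_def using assms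
    by (subst diff_conv_add_uminus, subst degree_add_eq_left) (auto simp: degree_monom_eq)
  hence P0: "P \<noteq> 0" using assms by auto
  have eq: "{x. poly P x = 0} = {x. x ^ n = c}"
    by (auto simp: P_def poly_monom)
  show "card {x. x ^ n = c} \<le> n"
    using card_poly_roots_bound[OF P0] eq d by simp
qed

text \<open>
  If \<open>k\<close> divides \<open>q - 1\<close>, the group of nonzero \<open>k\<close>-th powers consists of all \<open>n\<close>-th roots of
  unity for \<open>n = (q - 1) / k\<close>. Both \<open>x ^ k = 1\<close> and \<open>x ^ n = 1\<close> have at most as many
  solutions as their degree, and counting the fibres of the \<open>k\<close>-th power map forces equality.
\<close>
lemma power_residues_props:
  fixes k n :: nat
  assumes kn: "CARD('a::finite_field) - 1 = k * n"
  defines "R \<equiv> power_residues k :: 'a set"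
  shows card_power_residues: "card R = n"
    and power_residues_eq: "R = {y. y ^ n = 1}"
    and card_power_fibre: "\<And>y. y \<in> R \<Longrightarrow> card {x. x ^ k = y} = k"
proof -
  have pos: "k > 0" "n > 0"
    using kn CARD_finite_field_gt_1[where 'a='a] by (auto intro!: Nat.gr0I)
  have sub: "R \<subseteq> {y. y ^ n = 1}"
    using finite_field_power_card_minus_1[where 'a='a] kn
    by (auto simp: R_def power_residues_def simp flip: power_mult)
  have le: "card {y::'a. y ^ n = 1} \<le> n" by (rule card_nth_roots_le[OF pos(2)])
  have Rn: "card R \<le> n" using card_mono[OF _ sub] le by simp
  define c where "c = card {x::'a. x ^ k = 1}"
  have ck: "c \<le> k" unfolding c_def by (rule card_nth_roots_le[OF pos(1)])
  have fibre: "card {x. x ^ k = y} = c" if y: "y \<in> R" for y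
  proof -
    obtain z where z: "z \<noteq> 0" "y = z ^ k" using y unfolding R_def power_residues_def by blast
    show ?thesis unfolding c_def
      by (rule bij_betw_same_card[of "\<lambda>x. x / z"], rule bij_betw_byWitness[where f'="\<lambda>x. x * z"])
         (use z in \<open>auto simp: power_divide power_mult_distrib\<close>)
  qed
  have "UNIV - {0} = (\<Union>y\<in>R. {x. x ^ k = y})"
    using pos by (auto simp: R_def power_residues_def power_0_left)
  hence "CARD('a) - 1 = (\<Sum>y\<in>R. card {x. x ^ k = y})"
    unfolding card_UNIV_minus_0[symmetric] by (simp, subst card_UN_disjoint) auto
  hence eq: "k * n = card R * c" using fibre kn by simp
  have "k * n \<le> k * card R"
    unfolding eq using ck by (metis mult.commute mult_le_mono2)
  hence "n \<le> card R" using pos by simp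
  thus card: "card R = n" using Rn by simp
  show "R = {y. y ^ n = 1}"
    by (rule card_seteq[OF _ sub]) (use card le in auto)
  show "card {x. x ^ k = y} = k" if "y \<in> R" for y
    using fibre[OF that] eq card pos by simp
qed

lemma zero_notin_power_residues [simp]: "0 \<notin> power_residues k"
  by (auto simp: power_residues_def)

lemma power_residues_mult:
  "x \<in> power_residues k \<Longrightarrow> y \<in> power_residues k \<Longrightarrow> x * y \<in> power_residues k"
  unfolding power_residues_def by (smt (verit) mem_Collect_eq no_zero_divisors power_mult_distrib)

lemma power_residues_divide:
  "x \<in> power_residues k \<Longrightarrow> y \<in> power_residues k \<Longrightarrow> x / y \<in> power_residues k"
  unfolding power_residues_def by (smt (verit) mem_Collect_eq divide_eq_0_iff power_divide)

lemma uminus_power_residues: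
  fixes k n :: nat
  assumes "CARD('a::finite_field) - 1 = k * n" and "(- 1 :: 'a) ^ n = 1"
  shows "uminus ` (power_residues k :: 'a set) = power_residues k"
proof -
  have "(-1 :: 'a) \<in> power_residues k"
    using assms power_residues_eq[OF assms(1)] by simp
  hence "- y \<in> power_residues k" if "y \<in> power_residues k" for y :: 'a
    using power_residues_mult[OF that] by fastforce
  thus ?thesis by (force simp: image_iff intro: bexI[of _ "- y" for y])
qed

lemma minus_1_power_CHAR:
  assumes "CHAR('a::finite_field) - 1 dvd n"
  shows "(- 1 :: 'a) ^ n = 1"
proof (cases "CHAR('a) = 2")
  case True
  hence "(of_nat 2 :: 'a) = 0" using of_nat_CHAR[where 'a='a] by simp
  hence "(1::'a) + 1 = 0" by simp
  hence "(- 1 :: 'a) = 1" by (metis add_eq_0_iff)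
  thus ?thesis by (metis power_one)
next
  case False
  hence "odd CHAR('a)"
    using CHAR_prime[where 'a='a] prime_odd_nat prime_ge_2_nat by (metis le_neq_implies_less)
  hence "even (CHAR('a) - 1)" by simp
  hence "even n" using assms dvd_trans by blast
  thus ?thesis by simp
qed

lemma prime_field_in_power_residues:
  fixes k n j :: nat
  assumes kn: "CARD('a::finite_field) - 1 = k * n" and n: "CHAR('a) - 1 dvd n"
    and j: "0 < j" "j < CHAR('a)"
  shows "(of_nat j :: 'a) \<in> power_residues k"
proof -
  have j0: "(of_nat j :: 'a) \<noteq> 0"
    using j nat_dvd_not_less by (auto simp: of_nat_eq_0_iff_char_dvd)
  have "of_nat j * of_nat j ^ (CHAR('a) - 1) = (of_nat j :: 'a) ^ Suc (CHAR('a) - 1)"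
    by (rule power_Suc [symmetric])
  also have "\<dots> = of_nat j * 1" by (simp add: prime_field_power_CHAR)
  finally have "of_nat j ^ (CHAR('a) - 1) = (1 :: 'a)" using j0 by simp
  hence "of_nat j ^ n = (1 :: 'a)" using n by (auto simp: dvd_def power_mult)
  thus ?thesis using power_residues_eq[OF kn] by simp
qed

section \<open>Moments and size of the power sums\<close>

context additive_character
begin

text \<open>
  The complete exponential sum with exponent \<open>k\<close>. If \<open>k\<close> divides \<open>q - 1\<close>, it equals
  \<open>1 + k * \<eta>\<close>, where \<open>\<eta>\<close> is the character sum over the nonzero \<open>k\<close>-th powers.
\<close>
definition power_sum :: "nat \<Rightarrow> 'a \<Rightarrow> complex" where
  "power_sum k a = (\<Sum>x\<in>UNIV. \<psi> (a * x ^ k))"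

lemma power_sum_eq:
  fixes k n :: nat
  assumes kn: "CARD('a) - 1 = k * n"
  shows "power_sum k a = 1 + of_nat k * char_sum (power_residues k) a"
proof -
  have k: "k > 0"
    using kn CARD_finite_field_gt_1[where 'a='a] by (auto intro!: Nat.gr0I)
  have "power_sum k a = 1 + (\<Sum>x\<in>UNIV - {0}. \<psi> (a * x ^ k))"
    unfolding power_sum_def using k by (subst sum.remove[of _ 0]) (auto simp: power_0_left)
  also have "(\<Sum>x\<in>UNIV - {0}. \<psi> (a * x ^ k))
      = (\<Sum>y\<in>(\<lambda>x. x ^ k) ` (UNIV - {0}). \<Sum>x\<in>{x \<in> UNIV - {0}. x ^ k = y}. \<psi> (a * x ^ k))"
    by (rule sum.image_gen) simp
  also have "(\<lambda>x. x ^ k) ` (UNIV - {0}) = (power_residues k :: 'a set)"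
    by (auto simp: power_residues_def)
  also have "(\<Sum>y\<in>power_residues k. \<Sum>x\<in>{x \<in> UNIV - {0}. x ^ k = y}. \<psi> (a * x ^ k))
      = (\<Sum>y\<in>power_residues k. of_nat k * \<psi> (a * y))"
  proof (rule sum.cong[OF refl])
    fix y :: 'a assume y: "y \<in> power_residues k"
    have "{x \<in> UNIV - {0}. x ^ k = y} = {x. x ^ k = y}"
      using y k by (auto simp: power_residues_def power_0_left)
    thus "(\<Sum>x\<in>{x \<in> UNIV - {0}. x ^ k = y}. \<psi> (a * x ^ k)) = of_nat k * \<psi> (a * y)"
      using card_power_fibre[OF kn y] by simp
  qed
  finally show ?thesis by (simp add: char_sum_def sum_distrib_left)
qed

lemma power_sum_invariant:
  assumes "y \<in> power_residues k"
  shows "power_sum k (a * y) = power_sum k a"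
proof -
  obtain z where z: "z \<noteq> 0" "y = z ^ k" using assms unfolding power_residues_def by blast
  show ?thesis unfolding power_sum_def
    by (rule sum.reindex_bij_witness[of _ "\<lambda>x. x / z" "\<lambda>x. x * z"])
       (use z in \<open>auto simp: power_mult_distrib mult_ac\<close>)
qed

lemma sum_power_sum:
  assumes "k > 0"
  shows "(\<Sum>a\<in>UNIV - {0}. power_sum k a) = 0"
proof -
  have "(\<Sum>a\<in>UNIV. power_sum k a) = (\<Sum>x\<in>UNIV. \<Sum>a\<in>UNIV. \<psi> (x ^ k * a))"
    unfolding power_sum_def by (subst sum.swap) (simp add: mult.commute)
  also have "\<dots> = (\<Sum>x\<in>UNIV. if x = (0::'a) then of_nat CARD('a) else 0)"
    unfolding orthogonality using assms by (simp add: power_eq_0_iff)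
  finally have "(\<Sum>a\<in>UNIV. power_sum k a) = of_nat CARD('a)" by simp
  moreover have "power_sum k 0 = of_nat CARD('a)" by (simp add: power_sum_def)
  ultimately show ?thesis by (simp add: sum_diff1)
qed

lemma sum_char_sum:
  assumes "0 \<notin> S"
  shows "(\<Sum>a\<in>UNIV. char_sum S a) = 0"
proof -
  have "(\<Sum>a\<in>UNIV. char_sum S a) = (\<Sum>s\<in>S. \<Sum>a\<in>UNIV. \<psi> (s * a))"
    unfolding char_sum_def by (subst sum.swap) (simp add: mult.commute)
  thus ?thesis using assms unfolding orthogonality by (auto intro!: sum.neutral)
qed

lemma sum_char_sum_squared:
  assumes S: "uminus ` S = S"
  shows "(\<Sum>a\<in>UNIV. (char_sum S a)\<^sup>2) = of_nat CARD('a) * of_nat (card S)"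
proof -
  have inS: "- s \<in> S" if "s \<in> S" for s using S that by blast
  have "(char_sum S a)\<^sup>2 = (\<Sum>s\<in>S. \<Sum>t\<in>S. \<psi> ((s + t) * a))" for a
    by (simp add: char_sum_def power2_eq_square sum_product distrib_left mult.commute flip: add)
  hence "(\<Sum>a\<in>UNIV. (char_sum S a)\<^sup>2) = (\<Sum>s\<in>S. \<Sum>t\<in>S. \<Sum>a\<in>UNIV. \<psi> ((s + t) * a))"
    by (simp add: sum.swap[of _ UNIV])
  also have "\<dots> = (\<Sum>s\<in>S. \<Sum>t\<in>S. if t = - s then of_nat CARD('a) else 0)"
    unfolding orthogonality by (intro sum.cong refl) (auto simp: add_eq_0_iff)
  also have "\<dots> = (\<Sum>s\<in>S. of_nat CARD('a))"
    using inS by (intro sum.cong refl) (simp add: sum.delta)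
  finally show ?thesis by simp
qed

lemma sum_power_sum_squared:
  fixes k n :: nat
  assumes kn: "CARD('a) - 1 = k * n" and sym: "uminus ` power_residues k = (power_residues k :: 'a set)"
  shows "(\<Sum>a\<in>UNIV - {0}. (power_sum k a)\<^sup>2)
    = of_nat CARD('a) * of_nat (k * n) * (of_nat k - 1)"
proof -
  define R where "R = (power_residues k :: 'a set)"
  define q where "q = (of_nat CARD('a) :: complex)"
  have q: "q = 1 + of_nat k * of_nat n"
  proof -
    have "CARD('a) = 1 + k * n" using kn CARD_finite_field_gt_1[where 'a='a] by linarith
    thus ?thesis unfolding q_def by simp
  qed
  have "(\<Sum>a\<in>UNIV. (power_sum k a)\<^sup>2)
      = (\<Sum>a\<in>UNIV. 1 + 2 * of_nat k * char_sum R a + of_nat k ^ 2 * (char_sum R a)\<^sup>2)"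
    unfolding power_sum_eq[OF kn] R_def
    by (intro sum.cong refl) (simp add: power2_eq_square algebra_simps)
  also have "\<dots> = q + of_nat k ^ 2 * (q * of_nat n)"
    using sum_char_sum_squared[OF sym] sum_char_sum[of "power_residues k"] card_power_residues[OF kn]
    by (simp add: sum.distrib R_def q_def flip: sum_distrib_left)
  finally have "(\<Sum>a\<in>UNIV. (power_sum k a)\<^sup>2) = q + of_nat k ^ 2 * (q * of_nat n)" .
  moreover have "power_sum k 0 = q" by (simp add: power_sum_def q_def)
  ultimately have "(\<Sum>a\<in>UNIV - {0}. (power_sum k a)\<^sup>2) = q + of_nat k ^ 2 * (q * of_nat n) - q ^ 2"
    by (simp add: sum_diff1)
  also have "\<dots> = q * (of_nat k * of_nat n) * (of_nat k - 1)"
    unfolding q by (simp add: power2_eq_square algebra_simps)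
  finally show ?thesis by (simp add: q_def)
qed

lemma power_sum_real:
  fixes k n :: nat
  assumes "CARD('a) - 1 = k * n" and "uminus ` power_residues k = (power_residues k :: 'a set)"
  shows "power_sum k a \<in> \<real>"
  unfolding power_sum_eq[OF assms(1)] using char_sum_real[OF assms(2)] by simp

text \<open>
  Only the first two moments enter: \<open>power_sum k\<close> is constant on the coset of \<open>a\<close>, so the
  remaining \<open>k - 1\<close> cosets have to balance the value at \<open>a\<close>, and Cauchy-Schwarz bounds how
  large this value can be.
\<close>
lemma power_sum_bound:
  fixes k n :: nat
  assumes kn: "CARD('a) - 1 = k * n" and sym: "uminus ` power_residues k = (power_residues k :: 'a set)"
    and a: "a \<noteq> 0"
  shows "cmod (power_sum k a) \<le> (real k - 1) * sqrt CARD('a)"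
proof -
  have pos: "k > 0" "n > 0"
    using kn CARD_finite_field_gt_1[where 'a='a] by (auto intro!: Nat.gr0I)
  define f where "f b = Re (power_sum k b)" for b
  have f: "power_sum k b = of_real (f b)" for b
    using power_sum_real[OF kn sym] by (simp add: f_def of_real_Re)
  define q where "q = real CARD('a)"
  define B where "B = (\<lambda>y. a * y) ` power_residues k"
  define W where "W = UNIV - {0} - B"
  have cB: "card B = n"
    unfolding B_def using a card_power_residues[OF kn]
    by (subst card_image) (auto simp: inj_on_def)
  have B0: "B \<subseteq> UNIV - {0}" using a by (auto simp: B_def power_residues_def)
  have "card W = k * n - n"
    unfolding W_def using cB B0 kn by (subst card_Diff_subset) (auto simp: card_UNIV_minus_0)
  hence cW: "real (card W) = (real k - 1) * real n"
    using pos by (simp add: of_nat_diff algebra_simps)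
  have fB: "f b = f a" if "b \<in> B" for b
    using that power_sum_invariant by (auto simp: B_def f_def)
  have split: "(\<Sum>b\<in>UNIV - {0}. g b) = (\<Sum>b\<in>W. g b) + (\<Sum>b\<in>B. g b)" for g :: "'a \<Rightarrow> real"
    unfolding W_def using B0 by (intro sum.subset_diff) auto
  have "complex_of_real (\<Sum>b\<in>UNIV - {0}. f b) = of_real 0"
    using sum_power_sum[OF pos(1)] by (simp add: f)
  hence "(\<Sum>b\<in>UNIV - {0}. f b) = 0" using of_real_eq_iff by blast
  hence s1: "(\<Sum>b\<in>W. f b) = - (real n * f a)"
    using split[of f] fB cB by simp
  have "of_real (\<Sum>b\<in>UNIV - {0}. (f b)\<^sup>2) = (of_real (q * (real k * real n) * (real k - 1)) :: complex)"
    using sum_power_sum_squared[OF kn sym] by (simp add: f q_def)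
  hence "(\<Sum>b\<in>UNIV - {0}. (f b)\<^sup>2) = q * (real k * real n) * (real k - 1)"
    using of_real_eq_iff by blast
  hence s2: "(\<Sum>b\<in>W. (f b)\<^sup>2) = q * (real k * real n) * (real k - 1) - real n * (f a)\<^sup>2"
    using split[of "\<lambda>b. (f b)\<^sup>2"] fB cB by simp
  have "(\<Sum>b\<in>W. 1 * f b)\<^sup>2 \<le> (\<Sum>b\<in>W. 1\<^sup>2) * (\<Sum>b\<in>W. (f b)\<^sup>2)"
    by (rule Cauchy_Schwarz_ineq_sum)
  hence "(real n * f a)\<^sup>2
      \<le> (real k - 1) * real n * (q * (real k * real n) * (real k - 1) - real n * (f a)\<^sup>2)"
    using s1 s2 cW by simp
  also have "\<dots> = (real n)\<^sup>2 * ((real k - 1) * (q * real k * (real k - 1) - (f a)\<^sup>2))"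
    by (simp add: power2_eq_square algebra_simps)
  finally have "(f a)\<^sup>2 \<le> (real k - 1) * (q * real k * (real k - 1) - (f a)\<^sup>2)"
    using pos by (simp add: power_mult_distrib)
  hence "real k * (f a)\<^sup>2 \<le> real k * (q * (real k - 1)\<^sup>2)"
    by (simp add: power2_eq_square algebra_simps)
  hence "(f a)\<^sup>2 \<le> ((real k - 1) * sqrt q)\<^sup>2"
    using pos by (simp add: power_mult_distrib q_def mult.commute)
  hence "\<bar>f a\<bar> \<le> \<bar>(real k - 1) * sqrt q\<bar>" by (simp only: abs_le_square_iff)
  also have "\<dots> = (real k - 1) * sqrt q" using pos by (simp add: q_def)
  finally show ?thesis by (simp add: f q_def)
qed

end

section \<open>Power sums in the semiprimitive case\<close>

context additive_character
begin

text \<open>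
  If \<open>S\<close> is stable under the multiplicative group of the prime field, then the nontrivial
  \<open>p\<close>-th roots of unity all occur equally often among the terms of \<open>char_sum S a\<close>.
\<close>
lemma char_sum_integer:
  assumes stable: "\<And>j s. 0 < j \<Longrightarrow> j < CHAR('a) \<Longrightarrow> s \<in> S \<Longrightarrow> of_nat j * s \<in> S"
  shows "\<exists>i::int. char_sum S a = of_int i"
proof -
  define p where "p = CHAR('a)"
  have p: "prime p" by (simp add: p_def)
  hence p1: "p > 1" by (rule prime_gt_1_nat)
  define U where "U = {z::complex. z ^ p = 1}"
  have finU: "finite U" unfolding U_def using p1 by (intro finite_roots_unity) simp
  define N where "N z = card {s \<in> S. \<psi> (a * s) = z}" for z
  define \<omega> where "\<omega> = cis (2 * pi / real p)"
  have \<omega>_pow: "\<omega> ^ i = cis (2 * pi * real i / real p)" for i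
    by (simp add: \<omega>_def Complex.DeMoivre mult_ac)
  have \<omega>p: "\<omega> ^ p = 1" using p1 by (simp add: \<omega>_pow)
  have U: "U = (\<lambda>i. \<omega> ^ i) ` {..<p}"
    using Complex.bij_betw_roots_unity[of p] p1 by (simp add: bij_betw_def U_def \<omega>_pow)
  note \<omega>_mod = power_eq_power_mod[OF \<omega>p]
  have "N z \<le> N (z ^ j)" if j: "0 < j" "j < p" for z j
    unfolding N_def
  proof (rule card_inj_on_le[of "\<lambda>s. of_nat j * s"])
    have "(of_nat j :: 'a) \<noteq> 0"
      using j nat_dvd_not_less by (auto simp: of_nat_eq_0_iff_char_dvd p_def)
    thus "inj_on (\<lambda>s. of_nat j * s) {s \<in> S. \<psi> (a * s) = z}" by (auto simp: inj_on_def)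
    have "\<psi> (a * (of_nat j * s)) = \<psi> (a * s) ^ j" for s
      using of_nat_mult[of j "a * s"] by (simp add: mult_ac)
    thus "(\<lambda>s. of_nat j * s) ` {s \<in> S. \<psi> (a * s) = z} \<subseteq> {s \<in> S. \<psi> (a * s) = z ^ j}"
      using stable j by (auto simp: p_def)
  qed simp
  moreover have "\<exists>j. 0 < j \<and> j < p \<and> w = z ^ j" if zw: "z \<in> U" "w \<in> U" "z \<noteq> 1" "w \<noteq> 1" for z w
  proof -
    obtain i l where il: "i < p" "l < p" "z = \<omega> ^ i" "w = \<omega> ^ l" using zw unfolding U by blast
    have "i \<noteq> 0" using il zw by (cases i) auto
    hence "coprime i p"
      using il p by (metis coprime_commute nat_dvd_not_less neq0_conv prime_imp_coprime)
    then obtain x where x: "[i * x = Suc 0] (mod p)" using cong_solve_coprime_nat by blast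
    have "z ^ (x * l mod p) = \<omega> ^ ((i * (x * l mod p)) mod p)"
      using il \<omega>_mod by (metis power_mult)
    also have "(i * (x * l mod p)) mod p = ((i * x) mod p * l) mod p"
      by (simp add: mod_simps mult.assoc)
    also have "\<dots> = l"
      using x il p1 by (simp add: cong_def)
    finally have *: "w = z ^ (x * l mod p)" using il by simp
    hence "x * l mod p \<noteq> 0" using zw by (metis power_0)
    thus ?thesis using * p1 by (intro exI[of _ "x * l mod p"]) auto
  qed
  ultimately have "N z \<le> N w" if "z \<in> U" "w \<in> U" "z \<noteq> 1" "w \<noteq> 1" for z w
    using that by metis
  moreover have "\<omega> \<in> U" "\<omega> \<noteq> 1"
  proof -
    show "\<omega> \<in> U" using \<omega>p by (simp add: U_def)
    have "inj_on (\<lambda>i. \<omega> ^ i) {..<p}"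
      using Complex.bij_betw_roots_unity[of p] p1 by (simp add: bij_betw_def \<omega>_pow)
    from inj_onD[OF this, of 0 1] show "\<omega> \<noteq> 1" using p1 by auto
  qed
  ultimately have N: "N z = N \<omega>" if "z \<in> U" "z \<noteq> 1" for z using that by (meson le_antisym)
  have "char_sum S a = (\<Sum>z\<in>U. \<Sum>s | s \<in> S \<and> \<psi> (a * s) = z. \<psi> (a * s))"
    unfolding char_sum_def
    by (rule sum.group[symmetric]) (use finU power_CHAR in \<open>auto simp: U_def p_def\<close>)
  also have "\<dots> = (\<Sum>z\<in>U. of_nat (N z) * z)"
    by (rule sum.cong[OF refl]) (simp add: N_def)
  also have "\<dots> = of_nat (N 1) + (\<Sum>z\<in>U - {1}. of_nat (N z) * z)"
    using finU by (subst sum.remove[of _ 1]) (auto simp: U_def)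
  also have "(\<Sum>z\<in>U - {1}. of_nat (N z) * z) = of_nat (N \<omega>) * (\<Sum>z\<in>U - {1}. z)"
    unfolding sum_distrib_left using N by (intro sum.cong) auto
  also have "(\<Sum>z\<in>U - {1}. z) = - 1"
    using sum_roots_unity[OF p1] finU by (simp add: sum_diff1 U_def)
  finally have "char_sum S a = of_int (int (N 1) - int (N \<omega>))" by simp
  thus ?thesis by blast
qed

lemma power_sum_integer:
  fixes k n :: nat
  assumes kn: "CARD('a) - 1 = k * n" and n: "CHAR('a) - 1 dvd n"
  obtains i :: int where "power_sum k a = of_int (1 + int k * i)"
proof -
  have "\<exists>i::int. char_sum (power_residues k) a = of_int i"
    using prime_field_in_power_residues[OF kn n] power_residues_mult
    by (intro char_sum_integer) blast
  then obtain i :: int where "char_sum (power_residues k) a = of_int i" by blast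
  hence "power_sum k a = of_int (1 + int k * i)" using power_sum_eq[OF kn] by simp
  thus ?thesis by (rule that)
qed

text \<open>
  For \<open>r\<close> a power of the characteristic, \<open>x ^ (r + 1)\<close> behaves like a Hermitian form: the
  polar form \<open>x ^ r * z + x * z ^ r\<close> is biadditive. Hence the squared modulus is \<open>q\<close> times a
  character sum over the radical of this form, which is an integer as \<open>\<psi> (a * z ^ (r + 1))\<close> is
  multiplicative on the radical.
\<close>
lemma power_sum_hermitian:
  fixes r t :: nat
  assumes r: "r = CHAR('a) ^ t"
  shows "\<exists>c::nat. (cmod (power_sum (r + 1) a))\<^sup>2 = real CARD('a) * real c"
proof -
  have radd: "(x + y) ^ r = x ^ r + y ^ r" for x y :: 'a
    by (rule freshmans_dream') (simp_all add: r)
  have "r > 0" by (simp add: r)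
  hence rmin: "(- x) ^ r = - (x ^ r)" for x :: 'a
    using radd[of x "- x"] by (simp add: power_0_left add_eq_0_iff)
  define B where "B z x = \<psi> (a * (x ^ r * z + x * z ^ r))" for z x
  define A where "A = {z. \<forall>x. B z x = 1}"
  have B_add: "B z (x + y) = B z x * B z y" for z x y
    by (simp add: B_def radd algebra_simps flip: add)
  have B_add': "B (z + z') x = B z x * B z' x" for z z' x
    by (simp add: B_def radd algebra_simps flip: add)
  have B0: "B z 0 = 1" "B 0 x = 1" for z x using \<open>r > 0\<close> by (simp_all add: B_def power_0_left)
  have sumB: "(\<Sum>x\<in>UNIV. B z x) = (if z \<in> A then of_nat CARD('a) else 0)" for z
  proof (cases "z \<in> A")
    case False
    then obtain b where "B z b \<noteq> 1" by (auto simp: A_def)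
    thus ?thesis using False B_add
      by (auto intro!: sum_character_subgroup[where b=b])
  qed (simp add: A_def)
  define g where "g z = \<psi> (a * z ^ (r + 1))" for z
  have g_add: "g (x + z) = g x * g z * B z x" for x z
    by (simp add: g_def B_def radd algebra_simps flip: add)
  have gg: "g x * cnj (g x) = 1" for x
    unfolding g_def by (metis add minus add.right_inverse zero)
  have "of_real ((cmod (power_sum (r + 1) a))\<^sup>2)
      = (\<Sum>x\<in>UNIV. \<Sum>y\<in>UNIV. g y * cnj (g x))"
    unfolding complex_norm_square power_sum_def g_def[symmetric]
    by (simp add: sum_product sum.swap[of "\<lambda>x y. g y * cnj (g x)"])
  also have "\<dots> = (\<Sum>x\<in>UNIV. \<Sum>z\<in>UNIV. g (x + z) * cnj (g x))"
  proof (rule sum.cong[OF refl])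
    fix x
    show "(\<Sum>y\<in>UNIV. g y * cnj (g x)) = (\<Sum>z\<in>UNIV. g (x + z) * cnj (g x))"
      by (rule sum.reindex_bij_witness[of _ "\<lambda>z. x + z" "\<lambda>y. y - x"]) auto
  qed
  also have "\<dots> = (\<Sum>x\<in>UNIV. \<Sum>z\<in>UNIV. g z * B z x)"
    unfolding g_add using gg by (intro sum.cong refl) (simp add: mult_ac)
  also have "\<dots> = (\<Sum>z\<in>UNIV. g z * (\<Sum>x\<in>UNIV. B z x))"
    by (subst sum.swap) (simp add: sum_distrib_left)
  also have "\<dots> = (\<Sum>z\<in>UNIV. if z \<in> A then of_nat CARD('a) * g z else 0)"
    unfolding sumB by (intro sum.cong) auto
  also have "\<dots> = of_nat CARD('a) * (\<Sum>z\<in>A. g z)"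
    by (simp add: sum.If_cases sum_distrib_left)
  finally have eq: "of_real ((cmod (power_sum (r + 1) a))\<^sup>2) = of_nat CARD('a) * (\<Sum>z\<in>A. g z)" .
  have "\<exists>c::nat. (\<Sum>z\<in>A. g z) = of_nat c"
  proof (cases "\<exists>b\<in>A. g b \<noteq> 1")
    case True
    then obtain b where b: "b \<in> A" "g b \<noteq> 1" by blast
    have "(\<Sum>z\<in>A. g z) = 0"
    proof (rule sum_character_subgroup[where f=g and A=A and b=b])
      show "x + y \<in> A" if "x \<in> A" "y \<in> A" for x y
        using that by (simp add: A_def B_add')
      show "- x \<in> A" if "x \<in> A" for x
        using that B_add'[of x "- x"] by (simp add: A_def B0)
      show "g (x + y) = g x * g y" if "x \<in> A" "y \<in> A" for x y
        using that by (simp add: A_def g_add)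
    qed (fact b)+
    thus ?thesis by (intro exI[of _ 0]) simp
  qed (auto intro!: exI[of _ "card A"])
  then obtain c :: nat where "(\<Sum>z\<in>A. g z) = of_nat c" by blast
  hence "complex_of_real ((cmod (power_sum (r + 1) a))\<^sup>2) = of_real (real CARD('a) * real c)"
    using eq by simp
  thus ?thesis using of_real_eq_iff by blast
qed

text \<open>
  Every \<open>x ^ K\<close> is a \<open>k\<close>-th power, so after averaging over \<open>c\<close> each nonzero \<open>x\<close> contributes the
  full character sum over the group of \<open>k\<close>-th powers.
\<close>
lemma power_sum_average:
  fixes k K n :: nat
  assumes kn: "CARD('a) - 1 = k * n" and "k dvd K" "K > 0"
  shows "of_nat n * power_sum k a = (\<Sum>c\<in>power_residues k. power_sum K (a * c))"
proof -
  define R where "R = (power_residues k :: 'a set)"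
  have card: "card R = n" using card_power_residues[OF kn] by (simp add: R_def)
  have perm: "(\<Sum>c\<in>R. \<psi> (a * c * x ^ K)) = char_sum R a" if "x \<noteq> 0" for x
  proof -
    obtain d where "K = k * d" using \<open>k dvd K\<close> by blast
    hence "x ^ K = (x ^ d) ^ k" by (simp add: mult.commute flip: power_mult)
    hence xK: "x ^ K \<in> R" "x ^ K \<noteq> 0" using that unfolding R_def power_residues_def by auto
    show ?thesis unfolding char_sum_def
      by (rule sum.reindex_bij_witness[of _ "\<lambda>c. c / x ^ K" "\<lambda>c. c * x ^ K"])
         (use xK power_residues_mult power_residues_divide in \<open>auto simp: R_def mult_ac\<close>)
  qed
  have "(\<Sum>c\<in>R. power_sum K (a * c)) = (\<Sum>x\<in>UNIV. \<Sum>c\<in>R. \<psi> (a * c * x ^ K))"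
    unfolding power_sum_def by (rule sum.swap)
  also have "\<dots> = of_nat n + (\<Sum>x\<in>UNIV - {0}. \<Sum>c\<in>R. \<psi> (a * c * x ^ K))"
    using \<open>K > 0\<close> card by (subst sum.remove[of _ 0]) (auto simp: power_0_left)
  also have "(\<Sum>x\<in>UNIV - {0}. \<Sum>c\<in>R. \<psi> (a * c * x ^ K)) = of_nat (k * n) * char_sum R a"
    using perm kn by (simp add: card_UNIV_minus_0)
  finally show ?thesis
    unfolding power_sum_eq[OF kn] by (simp add: R_def algebra_simps)
qed

text \<open>
  The square of an integral power sum of exponent \<open>K = p ^ t + 1\<close> is divisible by \<open>q = h\<^sup>2\<close>, so the
  sum itself is divisible by \<open>h\<close>. The averaging identity passes this on to the divisors \<open>k\<close> of
  \<open>K\<close>, since \<open>(q - 1) / k\<close> is coprime to \<open>h\<close>.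
\<close>
lemma power_sum_divisible:
  fixes k n t h N :: nat
  assumes kn: "CARD('a) - 1 = k * n" and n: "CHAR('a) - 1 dvd n"
    and KN: "CARD('a) - 1 = (CHAR('a) ^ t + 1) * N" and N: "CHAR('a) - 1 dvd N"
    and k: "k dvd CHAR('a) ^ t + 1" and h: "CARD('a) = h\<^sup>2"
  obtains T :: int where "power_sum k a = of_int (int h * T)"
proof -
  define K where "K = CHAR('a) ^ t + 1"
  have "\<exists>T::int. power_sum K b = of_int (int h * T)" for b
  proof -
    obtain i :: int where i: "power_sum K b = of_int (1 + int K * i)"
      using power_sum_integer[OF KN N] unfolding K_def by metis
    obtain c :: nat where c: "(cmod (power_sum K b))\<^sup>2 = real CARD('a) * real c"
      using power_sum_hermitian[OF refl] unfolding K_def by blast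
    have "(real_of_int (1 + int K * i))\<^sup>2 = (cmod (power_sum K b))\<^sup>2"
      unfolding i norm_of_int by simp
    hence "real_of_int ((1 + int K * i)\<^sup>2) = real_of_int ((int h)\<^sup>2 * int c)"
      using c h by simp
    hence "(1 + int K * i)\<^sup>2 = (int h)\<^sup>2 * int c" by (simp only: of_int_eq_iff)
    hence "(int h)\<^sup>2 dvd (1 + int K * i)\<^sup>2" by simp
    hence "int h dvd 1 + int K * i" by simp
    then obtain T where "1 + int K * i = int h * T" by (auto simp: dvd_def)
    thus ?thesis using i by metis
  qed
  then obtain T where T: "\<And>b. power_sum K b = of_int (int h * T b)" by metis
  obtain i :: int where i: "power_sum k a = of_int (1 + int k * i)"
    using power_sum_integer[OF kn n] by metis
  have "of_nat n * power_sum k a = (\<Sum>c\<in>power_residues k. power_sum K (a * c))"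
    using k by (intro power_sum_average[OF kn]) (simp_all add: K_def)
  hence "of_int (int n * (1 + int k * i))
      = (of_int (int h * (\<Sum>c\<in>power_residues k. T (a * c))) :: complex)"
    unfolding T i by (simp add: sum_distrib_left)
  hence "int n * (1 + int k * i) = int h * (\<Sum>c\<in>power_residues k. T (a * c))"
    by (simp only: of_int_eq_iff)
  hence "int h dvd int n * (1 + int k * i)" by simp
  moreover have "coprime h n"
  proof (rule coprimeI)
    fix d assume d: "d dvd h" "d dvd n"
    have "d dvd CARD('a)" using d(1) unfolding h by (simp add: power2_eq_square)
    moreover have "d dvd CARD('a) - 1" using d(2) unfolding kn by simp
    ultimately have "d dvd CARD('a) - (CARD('a) - 1)" by (rule dvd_diff_nat)
    thus "is_unit d" using CARD_finite_field_gt_1[where 'a='a] by simp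
  qed
  ultimately have "int h dvd 1 + int k * i" by (simp add: coprime_dvd_mult_right_iff)
  then obtain T' where "1 + int k * i = int h * T'" by (auto simp: dvd_def)
  thus ?thesis using that i by metis
qed

text \<open>
  With \<open>q = h\<^sup>2\<close>, the quotients \<open>T = power_sum k a / h\<close> are integers congruent modulo \<open>k\<close> to
  the sign \<open>\<delta>\<close>, so that \<open>(T - \<delta>) (T - \<delta> + k \<delta>) \<ge> 0\<close>. By the first two moments these products
  have sum zero, so only the values \<open>\<delta>\<close> and \<open>\<delta> (1 - k)\<close> occur, and the second one does occur
  since the sum of all \<open>T\<close> vanishes.
\<close>
lemma power_sum_extremal:
  fixes k n t h N :: nat and \<delta> :: int
  assumes kn: "CARD('a) - 1 = k * n" and n: "CHAR('a) - 1 dvd n"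
    and KN: "CARD('a) - 1 = (CHAR('a) ^ t + 1) * N" and N: "CHAR('a) - 1 dvd N"
    and k: "k dvd CHAR('a) ^ t + 1" and h: "CARD('a) = h\<^sup>2"
    and \<delta>: "\<delta>\<^sup>2 = 1" "int k dvd int h - \<delta>"
  shows "\<exists>a. a \<noteq> 0 \<and> cmod (power_sum k a) = (real k - 1) * real h"
proof -
  have pos: "k > 0" "n > 0"
    using kn CARD_finite_field_gt_1[where 'a='a] by (auto intro!: Nat.gr0I)
  have h0: "h > 0" using h CARD_finite_field_gt_1[where 'a='a] by (auto intro!: Nat.gr0I)
  have sym: "uminus ` power_residues k = (power_residues k :: 'a set)"
    by (rule uminus_power_residues[OF kn minus_1_power_CHAR[OF n]])
  have "\<exists>T::int. power_sum k a = of_int (int h * T)" for a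
    using power_sum_divisible[OF kn n KN N k h] by metis
  then obtain T :: "'a \<Rightarrow> int" where T: "\<And>a. power_sum k a = of_int (int h * T a)" by metis
  have "int k dvd T a - \<delta>" for a
  proof -
    obtain i :: int where "power_sum k a = of_int (1 + int k * i)"
      using power_sum_integer[OF kn n] by metis
    hence "of_int (int h * T a) = (of_int (1 + int k * i) :: complex)" using T by metis
    hence i: "int h * T a = 1 + int k * i" by (simp only: of_int_eq_iff)
    obtain j where "int h - \<delta> = int k * j" using \<delta>(2) by (auto simp: dvd_def)
    hence j: "int h = \<delta> + int k * j" by simp
    have "T a - \<delta> = \<delta>\<^sup>2 * T a - \<delta>" using \<delta> by simp
    also have "\<dots> = \<delta> * (int h * T a - int k * j * T a - 1)"
      unfolding j by (simp add: algebra_simps power2_eq_square)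
    also have "\<dots> = int k * (\<delta> * (i - j * T a))"
      unfolding i by (simp add: algebra_simps)
    finally show ?thesis by simp
  qed
  hence "int k * ((T a - \<delta>) div int k) = T a - \<delta>" for a
    by (rule dvd_mult_div_cancel)
  hence z: "T a = \<delta> + int k * ((T a - \<delta>) div int k)" for a
    by (simp add: algebra_simps)
  let ?F = "UNIV - {0::'a}"
  have "complex_of_int (int h * (\<Sum>a\<in>?F. T a)) = of_int 0"
    using sum_power_sum[OF pos(1)] by (simp add: T sum_distrib_left)
  hence s1: "(\<Sum>a\<in>?F. T a) = 0" using h0 by (simp only: of_int_eq_iff) simp
  have "complex_of_int ((int h)\<^sup>2 * (\<Sum>a\<in>?F. (T a)\<^sup>2)) = of_int ((int h)\<^sup>2 * (int (k * n) * (int k - 1)))"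
    using sum_power_sum_squared[OF kn sym] h by (simp add: T sum_distrib_left power_mult_distrib)
  hence "(int h)\<^sup>2 * (\<Sum>a\<in>?F. (T a)\<^sup>2) = (int h)\<^sup>2 * (int (k * n) * (int k - 1))"
    by (simp only: of_int_eq_iff)
  hence s2: "(\<Sum>a\<in>?F. (T a)\<^sup>2) = int (k * n) * (int k - 1)" using h0 by simp
  have cardF: "int (card ?F) = int (k * n)" using kn by (simp add: card_UNIV_minus_0)
  have "(\<Sum>a\<in>?F. (T a - \<delta>) * (T a - \<delta> + int k * \<delta>))
      = (\<Sum>a\<in>?F. (T a)\<^sup>2 + (int k * \<delta> - 2 * \<delta>) * T a + \<delta>\<^sup>2 * (1 - int k))"
    by (intro sum.cong refl) (simp add: power2_eq_square algebra_simps)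
  also have "\<dots> = 0"
    unfolding sum.distrib sum_distrib_left[symmetric] s1 s2 using cardF \<delta> by (simp add: algebra_simps)
  finally have s0: "(\<Sum>a\<in>?F. (T a - \<delta>) * (T a - \<delta> + int k * \<delta>)) = 0" .
  have \<delta>': "\<delta> = 1 \<or> \<delta> = - 1" using \<delta>(1) by (simp add: power2_eq_1_iff)
  have "(T a - \<delta>) * (T a - \<delta> + int k * \<delta>) \<ge> 0" for a
  proof -
    obtain z where z: "T a = \<delta> + int k * z" using z by blast
    have "(T a - \<delta>) * (T a - \<delta> + int k * \<delta>) = (int k)\<^sup>2 * (z * (z + \<delta>))"
      by (simp add: z power2_eq_square algebra_simps)
    moreover have "z * (z + \<delta>) \<ge> 0"
      using \<delta>' by (cases "z \<le> -1 \<or> z = 0") (auto simp: zero_le_mult_iff)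
    ultimately show ?thesis by simp
  qed
  hence zero: "(T a - \<delta>) * (T a - \<delta> + int k * \<delta>) = 0" if "a \<noteq> 0" for a
    using s0 that by (subst (asm) sum_nonneg_eq_0_iff) auto
  have "\<exists>a\<in>?F. T a \<noteq> \<delta>"
  proof (rule ccontr)
    assume "\<not> ?thesis"
    hence "(\<Sum>a\<in>?F. T a) = int (k * n) * \<delta>" using cardF by simp
    thus False using s1 pos \<delta>' by auto
  qed
  then obtain a where a: "a \<noteq> 0" "T a \<noteq> \<delta>" by blast
  hence "T a - \<delta> + int k * \<delta> = 0" using zero[of a] by simp
  hence Ta: "T a = \<delta> * (1 - int k)" by (simp add: algebra_simps)
  have "cmod (power_sum k a) = \<bar>real_of_int (int h * T a)\<bar>"
    unfolding T norm_of_int by simp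
  also have "\<dots> = real h * (real k - 1)"
    using Ta \<delta>' pos by (auto simp: abs_mult)
  finally show ?thesis using a by (auto simp: mult.commute)
qed

end

section \<open>The Ramanujan property\<close>

lemma gen_paley_cayley: "gen_paley k = cayley_graph (power_residues k)"
  by (simp add: gen_paley_def cayley_graph_def)

lemma gen_paley_sum_cayley: "gen_paley_sum k = cayley_sum_graph (power_residues k)"
  by (simp add: gen_paley_sum_def cayley_sum_graph_def)

lemma complement_gen_paley_cayley:
  "graph_complement (gen_paley k) = cayley_graph (UNIV - {0} - power_residues k)"
  by (auto simp: graph_complement_def gen_paley_def cayley_graph_def)

lemma le_two_sqrtI:
  fixes x y c :: real
  assumes "c > 0" "y\<^sup>2 \<le> 4 * c\<^sup>2 * x" "y \<ge> 0"
  shows "y / c \<le> 2 * sqrt x"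
proof -
  have "(y / c)\<^sup>2 \<le> 4 * x" using assms by (simp add: power_divide divide_le_eq mult_ac)
  hence "y / c \<le> sqrt (4 * x)" by (rule real_le_rsqrt)
  thus ?thesis by (simp add: real_sqrt_mult)
qed

lemma two_sqrt_lessI:
  fixes x y c :: real
  assumes "c > 0" "4 * c\<^sup>2 * x < y\<^sup>2" "y \<ge> 0"
  shows "2 * sqrt x < y / c"
proof -
  have "4 * x < (y / c)\<^sup>2" using assms by (simp add: power_divide less_divide_eq mult_ac)
  hence "sqrt (4 * x) < y / c" using assms by (intro real_less_lsqrt) auto
  thus ?thesis by (simp add: real_sqrt_mult)
qed

text \<open>
  The common setting of all cases: \<open>h\<close> is the square root of the order of the field, \<open>n\<close> is the
  degree of the generalized Paley graph, and \<open>k \<le> h\<close> keeps the other eigenvalues below \<open>n\<close>.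
\<close>
locale power_residue_character = additive_character \<psi>
  for \<psi> :: "'a::finite_field \<Rightarrow> complex" +
  fixes k n :: nat and h :: real
  assumes kn: "CARD('a) - 1 = k * n"
    and sym: "uminus ` power_residues k = (power_residues k :: 'a set)"
    and h: "h\<^sup>2 = real CARD('a)" "h > 0"
    and k_le: "k \<ge> 2" "real k \<le> h"
    and CARD_ge: "CARD('a) \<ge> 5"
begin

lemma n_eq: "real n = (h\<^sup>2 - 1) / real k"
proof -
  have "h\<^sup>2 - 1 = real (CARD('a) - 1)" using CARD_ge by (simp add: h of_nat_diff)
  also have "\<dots> = real k * real n" unfolding kn by simp
  finally show ?thesis using k_le by simp
qed

lemma h_gt_2: "h > 2"
proof -
  have "2\<^sup>2 < h\<^sup>2" using h CARD_ge by simp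
  thus ?thesis using h(2) by (rule power_less_imp_less_base[OF _ less_imp_le])
qed

lemma power_sum_le: "a \<noteq> 0 \<Longrightarrow> cmod (power_sum k a) \<le> (real k - 1) * h"
  using power_sum_bound[OF kn sym, of a] real_sqrt_unique[OF h(1)] h(2) by simp

lemma char_sum_eq: "char_sum (power_residues k) a = (power_sum k a - 1) / of_nat k"
  using power_sum_eq[OF kn, of a] k_le by simp

lemma char_sum_le:
  assumes "a \<noteq> 0"
  shows "cmod (char_sum (power_residues k) a) \<le> ((real k - 1) * h + 1) / real k"
proof -
  have "cmod (power_sum k a - 1) \<le> (real k - 1) * h + 1"
    using power_sum_le[OF assms] norm_triangle_ineq4[of "power_sum k a" 1] by simp
  thus ?thesis unfolding char_sum_eq using k_le by (simp add: norm_divide divide_right_mono)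
qed

lemma ramanujan_power_residues_iff:
  fixes E :: "'a rel"
  assumes E: "E = gen_paley k \<or> E = gen_paley_sum k"
  shows "ramanujan E \<longleftrightarrow>
    (\<forall>a. a \<noteq> 0 \<longrightarrow> cmod (char_sum (power_residues k) a) \<le> 2 * sqrt (real n - 1))"
proof -
  have "cmod (char_sum (power_residues k) a) < real (card (power_residues k :: 'a set))"
    if "a \<noteq> 0" for a
  proof -
    have "(real k - 1) * h + 1 \<le> (h - 1) * h + 1"
      using k_le h(2) by (intro add_right_mono mult_right_mono) auto
    also have "\<dots> < h\<^sup>2 - 1" using h_gt_2 by (simp add: power2_eq_square algebra_simps)
    finally have "((real k - 1) * h + 1) / real k < real n"
      unfolding n_eq using k_le by (intro divide_strict_right_mono) auto
    thus ?thesis using char_sum_le[OF that] card_power_residues[OF kn] by simp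
  qed
  from ramanujan_cayley_iff[OF sym _ this, of E] show ?thesis
    using E card_power_residues[OF kn] by (simp add: gen_paley_cayley gen_paley_sum_cayley)
qed

lemma ramanujan_power_residuesI:
  fixes E :: "'a rel"
  assumes E: "E = gen_paley k \<or> E = gen_paley_sum k"
    and le: "((real k - 1) * h + 1)\<^sup>2 \<le> 4 * real k * (h\<^sup>2 - 1 - real k)"
  shows "ramanujan E"
  unfolding ramanujan_power_residues_iff[OF E]
proof safe
  fix a :: 'a assume "a \<noteq> 0"
  have "((real k - 1) * h + 1) / real k \<le> 2 * sqrt (real n - 1)"
  proof (rule le_two_sqrtI)
    have "4 * real k * (h\<^sup>2 - 1 - real k) = 4 * (real k)\<^sup>2 * (real n - 1)"
      unfolding n_eq using k_le by (simp add: field_simps power2_eq_square)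
    thus "((real k - 1) * h + 1)\<^sup>2 \<le> 4 * (real k)\<^sup>2 * (real n - 1)" using le by simp
  qed (use k_le h in auto)
  thus "cmod (char_sum (power_residues k) a) \<le> 2 * sqrt (real n - 1)"
    using char_sum_le[OF \<open>a \<noteq> 0\<close>] by simp
qed

lemma not_ramanujan_power_residues:
  fixes E :: "'a rel"
  assumes E: "E = gen_paley k \<or> E = gen_paley_sum k"
    and a: "a \<noteq> 0" "cmod (power_sum k a) = (real k - 1) * h"
    and k6: "k \<ge> 6"
  shows "\<not> ramanujan E"
proof -
  have "2 * sqrt (real n - 1) < ((real k - 1) * h - 1) / real k"
  proof (rule two_sqrt_lessI)
    define x where "x = real k - 1"
    have x: "x \<ge> 5" "real k = x + 1" using k6 by (simp_all add: x_def)
    have "4 * (real k)\<^sup>2 * (real n - 1) = 4 * real k * (h\<^sup>2 - 1 - real k)"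
      unfolding n_eq using k_le by (simp add: field_simps power2_eq_square)
    \<comment> \<open>The coefficient \<open>(k - 1)\<^sup>2 - 4 * k\<close> of \<open>h\<^sup>2\<close> in the difference is at least \<open>1\<close> for
      \<open>k \<ge> 6\<close>; completing the square leaves only terms of one sign.\<close>
    also have "\<dots> = (x * h - 1)\<^sup>2 - (h - x)\<^sup>2 - (3 * x\<^sup>2 + 12 * x + 9) - (x - 5) * (x + 1) * h\<^sup>2"
      unfolding x by (simp add: power2_eq_square algebra_simps)
    also have "\<dots> < (x * h - 1)\<^sup>2"
    proof -
      have "(x - 5) * (x + 1) * h\<^sup>2 \<ge> 0" using x by simp
      moreover have "3 * x\<^sup>2 + 12 * x + 9 > 0" using x by (intro add_pos_pos) auto
      ultimately show ?thesis by (smt (verit) zero_le_power2)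
    qed
    finally show "4 * (real k)\<^sup>2 * (real n - 1) < ((real k - 1) * h - 1)\<^sup>2" by (simp add: x_def)
    have "1 * 1 \<le> (real k - 1) * h" using k_le h_gt_2 by (intro mult_mono) auto
    thus "0 \<le> (real k - 1) * h - 1" by simp
  qed (use k_le in auto)
  also have "(real k - 1) * h - 1 \<le> cmod (power_sum k a - 1)"
    using a(2) norm_triangle_ineq2[of "power_sum k a" 1] by simp
  hence "((real k - 1) * h - 1) / real k \<le> cmod (char_sum (power_residues k) a)"
    unfolding char_sum_eq using k_le by (simp add: norm_divide divide_right_mono)
  finally show ?thesis unfolding ramanujan_power_residues_iff[OF E] using a(1) by force
qed

text \<open>
  The nontrivial eigenvalues of the complement are \<open>- 1 - \<eta> = - (k - 1 + power_sum k a) / k\<close>, so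
  they are at most \<open>(k - 1) * (1 + h) / k\<close> in absolute value, while the degree is of order \<open>h\<^sup>2\<close>.
\<close>
lemma ramanujan_complement: "ramanujan (graph_complement (gen_paley k :: 'a rel))"
proof -
  define S where "S = UNIV - {0} - (power_residues k :: 'a set)"
  have inR: "- y \<in> power_residues k" if "y \<in> power_residues k" for y :: 'a
    using sym that by blast
  have "- s \<in> S" if "s \<in> S" for s
    using that inR[of "- s"] by (auto simp: S_def)
  hence symS: "uminus ` S = S" by (force simp: image_iff intro: bexI[of _ "- s" for s])
  have "card S = k * n - n"
    unfolding S_def using card_power_residues[OF kn] kn
    by (subst card_Diff_subset) (auto simp: card_UNIV_minus_0)
  hence cS: "real (card S) = (real k - 1) * real n"
    using k_le by (simp add: of_nat_diff algebra_simps)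
  have bound: "cmod (char_sum S a) \<le> (real k - 1) * (1 + h) / real k" if "a \<noteq> 0" for a
  proof -
    have "(\<Sum>s\<in>UNIV. \<psi> (a * s)) = 0" using orthogonality[of a] that by simp
    moreover have "(\<Sum>s\<in>UNIV. \<psi> (a * s)) = 1 + (\<Sum>s\<in>UNIV - {0}. \<psi> (a * s))"
      by (subst sum.remove[of _ 0]) auto
    moreover have "(\<Sum>s\<in>UNIV - {0}. \<psi> (a * s)) = char_sum S a + char_sum (power_residues k) a"
      unfolding char_sum_def S_def by (rule sum.subset_diff) auto
    ultimately have "char_sum S a = - 1 - char_sum (power_residues k) a"
      by (simp add: algebra_simps eq_neg_iff_add_eq_0)
    also have "\<dots> = - ((of_nat k - 1) + power_sum k a) / of_nat k"
      unfolding char_sum_eq using k_le by (simp add: field_simps)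
    finally have "cmod (char_sum S a) = cmod (of_real (real k - 1) + power_sum k a) / real k"
      by (simp only: norm_divide norm_minus_cancel) simp
    also have "cmod (of_real (real k - 1) + power_sum k a) \<le> (real k - 1) * (1 + h)"
      using norm_triangle_ineq[of "of_real (real k - 1)" "power_sum k a"] power_sum_le[OF that] k_le
      by (simp add: algebra_simps del: of_real_diff)
    finally show ?thesis using k_le by (simp add: divide_right_mono)
  qed
  have less: "cmod (char_sum S a) < card S" if "a \<noteq> 0" for a
  proof -
    have "(real k - 1) * (1 + h) < (real k - 1) * (h\<^sup>2 - 1)"
    proof -
      have "0 < (real k - 1) * ((h + 1) * (h - 2))" using h_gt_2 k_le by simp
      thus ?thesis by (simp add: power2_eq_square algebra_simps)
    qed
    hence "(real k - 1) * (1 + h) / real k < (real k - 1) * real n"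
      unfolding n_eq using k_le by (simp add: divide_strict_right_mono)
    thus ?thesis using bound[OF that] cS by simp
  qed
  have "(real k - 1) * (1 + h) / real k \<le> 2 * sqrt ((real k - 1) * real n - 1)"
  proof (rule le_two_sqrtI)
    define x where "x = real k - 1"
    have x: "x \<ge> 1" "real k = x + 1" using k_le by (simp_all add: x_def)
    have h5: "h\<^sup>2 \<ge> 5" using h CARD_ge by simp
    \<comment> \<open>Replacing \<open>2 * h\<close> by \<open>h\<^sup>2\<close> leaves an inequality that is linear in \<open>h\<^sup>2 \<ge> 5\<close>.\<close>
    have "2 * h \<le> h\<^sup>2" using h_gt_2 by (simp add: power2_eq_square)
    hence "(x * (1 + h))\<^sup>2 \<le> x\<^sup>2 * (1 + 2 * h\<^sup>2)"
      unfolding power_mult_distrib by (intro mult_left_mono) (auto simp: power2_sum)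
    also have "\<dots> = 4 * (x + 1) * (x * (h\<^sup>2 - 1) - (x + 1))
        - ((2 * x\<^sup>2 + 4 * x) * (h\<^sup>2 - 5) + (x\<^sup>2 + 8 * x - 4))"
      by (simp add: power2_eq_square algebra_simps)
    also have "\<dots> \<le> 4 * (x + 1) * (x * (h\<^sup>2 - 1) - (x + 1))"
    proof -
      have "(2 * x\<^sup>2 + 4 * x) * (h\<^sup>2 - 5) \<ge> 0" using x h5 by (intro mult_nonneg_nonneg) auto
      moreover have "x\<^sup>2 + 8 * x - 4 \<ge> 0" using x by (smt (verit) zero_le_power2)
      ultimately show ?thesis by simp
    qed
    also have "\<dots> = 4 * (real k)\<^sup>2 * ((real k - 1) * real n - 1)"
      unfolding n_eq x using x by (simp add: field_simps power2_eq_square)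
    finally show "((real k - 1) * (1 + h))\<^sup>2 \<le> 4 * (real k)\<^sup>2 * ((real k - 1) * real n - 1)"
      by (simp add: x_def)
  qed (use k_le h in auto)
  thus ?thesis
    using ramanujan_cayley_iff[OF symS disjI1[OF refl] less] bound cS
    unfolding complement_gen_paley_cayley S_def[symmetric] by fastforce
qed

end

section \<open>Semiprimitive pairs\<close>

lemma diff_dvd_power_diff: "(x::int) - y dvd x ^ s - y ^ s"
  by (simp add: power_diff_sumr2)

lemma dvd_power_minus_1:
  fixes p t s :: nat
  assumes "p > 0"
  shows "(p - 1) * (p ^ t + 1) dvd p ^ (2 * t * s) - 1"
proof -
  define P where "P = int p"
  have "P - 1 dvd P ^ t - 1" using diff_dvd_power_diff[of P 1 t] by simp
  hence "(P - 1) * (P ^ t + 1) dvd (P ^ t - 1) * (P ^ t + 1)" by (rule mult_dvd_mono) simp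
  also have "(P ^ t - 1) * (P ^ t + 1) = P ^ (2 * t) - 1"
    unfolding mult_2 power_add by (simp add: algebra_simps)
  also have "\<dots> dvd P ^ (2 * t * s) - 1"
    using diff_dvd_power_diff[of "P ^ (2 * t)" 1 s] by (simp add: power_mult)
  finally have "(P - 1) * (P ^ t + 1) dvd P ^ (2 * t * s) - 1" .
  also have "(P - 1) * (P ^ t + 1) = int ((p - 1) * (p ^ t + 1))"
    unfolding of_nat_mult of_nat_add of_nat_power P_def using assms by (simp add: of_nat_diff)
  also have "P ^ (2 * t * s) - 1 = int (p ^ (2 * t * s) - 1)"
    using assms by (simp add: P_def of_nat_diff)
  finally show ?thesis by (simp only: int_dvd_int_iff)
qed

lemma mod_3_if_dvd_power_plus_1:
  fixes p t :: nat
  assumes "t > 0" "3 dvd p ^ t + 1"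
  shows "p mod 3 = 2"
proof -
  have "((p mod 3) ^ t + 1) mod 3 = 0"
    using assms(2) by (metis dvd_imp_mod_0 mod_add_left_eq power_mod)
  moreover have "((0::nat) ^ t + 1) mod 3 \<noteq> 0" "((1::nat) ^ t + 1) mod 3 \<noteq> 0"
    unfolding zero_power[OF assms(1)] power_one by presburger+
  ultimately have "p mod 3 \<noteq> 0" "p mod 3 \<noteq> 1" by metis+
  thus ?thesis by presburger
qed

lemma mod_4_if_dvd_power_plus_1:
  fixes p t :: nat
  assumes "t > 0" "4 dvd p ^ t + 1"
  shows "p mod 4 = 3"
proof -
  have "odd p"
  proof
    assume "even p"
    hence "odd (p ^ t + 1)" using assms(1) by simp
    moreover have "2 dvd (4::nat)" by simp
    ultimately show False using assms(2) dvd_trans by blast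
  qed
  have "((p mod 4) ^ t + 1) mod 4 = 0"
    using assms(2) by (metis dvd_imp_mod_0 mod_add_left_eq power_mod)
  moreover have "((1::nat) ^ t + 1) mod 4 \<noteq> 0"
    unfolding power_one by presburger
  ultimately have "p mod 4 \<noteq> 1" by metis
  with \<open>odd p\<close> show ?thesis by presburger
qed

text \<open>If \<open>p\<close> generates the group of units modulo \<open>5\<close>, then \<open>-1\<close> is an even power of it.\<close>
lemma mod_5_if_dvd_power_plus_1:
  fixes p t :: nat
  assumes "t > 0" "5 dvd p ^ t + 1"
  shows "p mod 5 = 4 \<or> (p mod 5 = 2 \<or> p mod 5 = 3) \<and> even t"
proof -
  have *: "((p mod 5) ^ t + 1) mod 5 = 0"
    using assms(2) by (metis dvd_imp_mod_0 mod_add_left_eq power_mod)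
  moreover have "((0::nat) ^ t + 1) mod 5 \<noteq> 0" "((1::nat) ^ t + 1) mod 5 \<noteq> 0"
    unfolding zero_power[OF assms(1)] power_one by presburger+
  ultimately have "p mod 5 \<noteq> 0" "p mod 5 \<noteq> 1" by metis+
  moreover have "even t" if "p mod 5 = 2 \<or> p mod 5 = 3"
  proof (rule ccontr)
    assume "odd t"
    then obtain u where u: "t = 2 * u + 1" by (elim oddE)
    have "((p mod 5)\<^sup>2) mod 5 = 4" using that by auto
    hence "((p mod 5) ^ t) mod 5 = (4 ^ u * (p mod 5)) mod 5"
      unfolding u power_add power_mult by (metis mod_mult_left_eq power_mod power_one_right)
    moreover have "(4::nat) ^ u mod 5 = 1 \<or> (4::nat) ^ u mod 5 = 4"
    proof (induction u)
      case (Suc u)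
      have "(4::nat) ^ Suc u mod 5 = (4 * (4 ^ u mod 5)) mod 5" by (simp add: mod_mult_right_eq)
      thus ?case using Suc by auto
    qed simp
    hence "(4 ^ u * (p mod 5)) mod 5 = 2 \<or> (4 ^ u * (p mod 5)) mod 5 = 3"
      using that by (auto simp: mod_mult_left_eq[of "4 ^ u" 5, symmetric])
    ultimately show False using * by presburger
  qed
  moreover have "p mod 5 < 5" by simp
  ultimately show ?thesis by linarith
qed

lemma gen_paley_inject:
  fixes k l :: nat
  assumes "gen_paley k = (gen_paley l :: 'a::finite_field rel)"
    and "k dvd CARD('a) - 1" and "l dvd CARD('a) - 1"
  shows "k = l"
proof -
  have "power_residues k = (power_residues l :: 'a set)"
    using arg_cong[OF assms(1), of "\<lambda>E. E `` {0}"] by (simp add: gen_paley_def Image_def)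
  moreover obtain n where n: "CARD('a) - 1 = k * n" using assms(2) by blast
  moreover obtain n' where n': "CARD('a) - 1 = l * n'" using assms(3) by blast
  ultimately have "n = n'"
    using card_power_residues[OF n] card_power_residues[OF n'] by simp
  moreover have "n > 0"
    using n CARD_finite_field_gt_1[where 'a='a] by (auto intro!: Nat.gr0I)
  ultimately show ?thesis using n n' by simp
qed

lemma paley_2_ramanujan:
  fixes E :: "'a::finite_field rel"
  assumes "prime p" and "CARD('a) = p ^ m" and "CARD('a) mod 4 = 1"
    and E: "E = gen_paley 2 \<or> E = gen_paley_sum 2 \<or> E = graph_complement (gen_paley 2)"
  shows "ramanujan E"
proof -
  obtain \<psi> :: "'a \<Rightarrow> complex" where "additive_character \<psi>"
    using additive_character_exists[OF assms(1,2)] by blast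
  then interpret additive_character \<psi> .
  define n where "n = CARD('a) div 2"
  have kn: "CARD('a) - 1 = 2 * n" and "even n" and ge: "CARD('a) \<ge> 5"
    using assms(3) CARD_finite_field_gt_1[where 'a='a] unfolding n_def by presburger+
  interpret power_residue_character \<psi> 2 n "sqrt (real CARD('a))"
  proof
    show "uminus ` power_residues 2 = (power_residues 2 :: 'a set)"
      by (rule uminus_power_residues[OF kn]) (use \<open>even n\<close> in simp)
    have "(2::real) = sqrt 4" by simp
    also have "\<dots> \<le> sqrt (real CARD('a))" using ge by (intro real_sqrt_le_mono) linarith
    finally show "real 2 \<le> sqrt (real CARD('a))" by simp
  qed (use kn ge in auto)
  have "ramanujan E" if "E = gen_paley 2 \<or> E = gen_paley_sum 2"
  proof (rule ramanujan_power_residuesI[OF that])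
    define h where "h = sqrt (real CARD('a))"
    have h: "h\<^sup>2 \<ge> 5" "h > 2" using ge h_gt_2 by (simp_all add: h_def)
    have "2 * h \<le> h\<^sup>2" using h(2) by (simp add: power2_eq_square)
    hence "(h + 1)\<^sup>2 \<le> 8 * (h\<^sup>2 - 3)" using h(1) by (simp add: power2_sum)
    thus "((real 2 - 1) * sqrt (real CARD('a)) + 1)\<^sup>2
        \<le> 4 * real 2 * ((sqrt (real CARD('a)))\<^sup>2 - 1 - real 2)"
      by (simp add: h_def)
  qed
  thus ?thesis using E ramanujan_complement by blast
qed

text \<open>
  For \<open>k > 2\<close> the order of the field is a square \<open>h\<^sup>2\<close>. The Ramanujan condition amounts, up
  to lower order terms, to \<open>(k - 1)\<^sup>2 \<le> 4 * k\<close>, that is, to \<open>k \<le> 5\<close>.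
\<close>
lemma semiprimitive_ramanujan_iff:
  fixes E :: "'a::finite_field rel" and p k s t :: nat
  assumes p: "prime p" and card: "CARD('a) = p ^ (2 * t * s)"
    and k2: "k > 2" and t: "t > 0" and k: "k dvd p ^ t + 1" and kne: "k \<noteq> p ^ (t * s) + 1"
  shows "E = gen_paley k \<or> E = gen_paley_sum k \<Longrightarrow> ramanujan E \<longleftrightarrow> k \<le> 5"
    and "ramanujan (graph_complement (gen_paley k :: 'a rel))"
proof -
  have char: "CHAR('a) = p" by (rule finite_field_CHAR[OF p card])
  have p1: "p > 1" using p by (rule prime_gt_1_nat)
  have s: "s > 0"
    using card CARD_finite_field_gt_1[where 'a='a] by (auto intro!: Nat.gr0I)
  obtain \<psi> :: "'a \<Rightarrow> complex" where "additive_character \<psi>"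
    using additive_character_exists[OF p card] by blast
  then interpret additive_character \<psi> .
  define h where "h = p ^ (t * s)"
  have hq: "CARD('a) = h\<^sup>2" unfolding card h_def by (simp add: mult_ac flip: power_mult)
  obtain M where M: "CARD('a) - 1 = (p - 1) * (p ^ t + 1) * M"
    using dvd_power_minus_1[of p t s] p1 card by (auto simp: dvd_def)
  define N where "N = (p - 1) * M"
  have KN: "CARD('a) - 1 = (CHAR('a) ^ t + 1) * N" "CHAR('a) - 1 dvd N"
    unfolding M N_def char by (simp_all only: mult_ac dvd_triv_left dvd_triv_right)
  obtain d where d: "p ^ t + 1 = k * d" using k by blast
  define n where "n = d * N"
  have kq: "CARD('a) - 1 = k * n" "CHAR('a) - 1 dvd n"
    using KN unfolding char d n_def by (simp_all only: mult.assoc dvd_mult)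
  \<comment> \<open>For \<open>s = 1\<close>, \<open>k\<close> is a proper divisor of \<open>h + 1\<close>; for \<open>s > 1\<close>, already \<open>p ^ t + 1 \<le> h\<close>.\<close>
  have k_le: "k \<le> h"
  proof (cases "s = 1")
    case True
    have "k \<le> p ^ t + 1" by (rule dvd_imp_le[OF k]) simp
    thus ?thesis using kne True by (simp add: h_def)
  next
    case False
    have "k \<le> p ^ t + 1" by (rule dvd_imp_le[OF k]) simp
    also have "\<dots> \<le> p ^ t * 2" using p1 by simp
    also have "\<dots> \<le> p ^ t * p" using p1 by (intro mult_left_mono) auto
    also have "\<dots> = p ^ (t + 1)" by simp
    also have "\<dots> \<le> h"
      unfolding h_def
    proof (rule power_increasing)
      have "t + 1 \<le> t * 2" using t by simp
      also have "\<dots> \<le> t * s" using False s by (intro mult_left_mono) auto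
      finally show "t + 1 \<le> t * s" .
    qed (use p1 in simp)
    finally show ?thesis .
  qed
  have h3: "h \<ge> 3" using k_le k2 by simp
  have h9: "h\<^sup>2 \<ge> 9" using power_mono[OF h3, of 2] by simp
  interpret power_residue_character \<psi> k n "real h"
  proof
    show "uminus ` power_residues k = (power_residues k :: 'a set)"
      by (rule uminus_power_residues[OF kq(1) minus_1_power_CHAR[OF kq(2)]])
  qed (use kq hq k2 k_le h3 h9 in auto)
  show "ramanujan (graph_complement (gen_paley k :: 'a rel))" by (rule ramanujan_complement)
  assume E: "E = gen_paley k \<or> E = gen_paley_sum k"
  show "ramanujan E \<longleftrightarrow> k \<le> 5"
  proof
    assume "ramanujan E"
    define \<delta> :: int where "\<delta> = (- 1) ^ s"
    have \<delta>: "\<delta>\<^sup>2 = 1" by (simp add: \<delta>_def flip: power_mult)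
    have "int k dvd int (p ^ t + 1)" using k by (simp only: int_dvd_int_iff)
    also have "int (p ^ t + 1) = int p ^ t - (- 1)" by simp
    also have "\<dots> dvd (int p ^ t) ^ s - (- 1) ^ s" by (rule diff_dvd_power_diff)
    also have "\<dots> = int h - \<delta>" by (simp add: h_def \<delta>_def power_mult)
    finally have "int k dvd int h - \<delta>" .
    obtain a where "a \<noteq> 0" "cmod (power_sum k a) = (real k - 1) * real h"
      using power_sum_extremal[OF kq KN _ hq \<delta> \<open>int k dvd int h - \<delta>\<close>] k char by metis
    thus "k \<le> 5" using not_ramanujan_power_residues[OF E] \<open>ramanujan E\<close> by force
  next
    assume "k \<le> 5"
    hence k345: "k = 3 \<or> k = 4 \<or> k = 5" using k2 by linarith
    \<comment> \<open>For \<open>k = 5\<close> the inequality needs \<open>h \<ge> 7\<close>. The value \<open>h = 5\<close> is excluded by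
      \<open>k dvd h\<^sup>2 - 1\<close>, and \<open>6\<close> is not a prime power.\<close>
    have h7: "h \<ge> 7" if "k = 5"
    proof -
      have "h \<noteq> 5"
      proof
        assume "h = 5"
        hence "24 = 5 * n" using kq(1) hq that by simp
        thus False by presburger
      qed
      moreover have "h \<noteq> 6"
      proof
        assume "h = 6"
        hence h6: "p ^ (t * s) = 6" by (simp add: h_def)
        have "2 dvd p ^ (t * s)" "3 dvd p ^ (t * s)" unfolding h6 by simp_all
        hence "2 dvd p" "3 dvd p" using prime_dvd_power[of 2 p] prime_dvd_power[of 3 p] by simp_all
        thus False using p primes_dvd_imp_eq[of 2 p] primes_dvd_imp_eq[of 3 p] by simp
      qed
      ultimately show ?thesis using k_le that by linarith
    qed
    have mono: "real c * real h \<le> (real h)\<^sup>2" if "c \<le> h" for c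
      using that by (simp add: power2_eq_square mult_right_mono)
    show "ramanujan E"
    proof (rule ramanujan_power_residuesI[OF E])
      consider "k = 3" | "k = 4" | "k = 5" using k345 by blast
      thus "((real k - 1) * real h + 1)\<^sup>2 \<le> 4 * real k * ((real h)\<^sup>2 - 1 - real k)"
      proof cases
        case 1
        thus ?thesis using mono[OF h3] h3 by (simp add: power2_sum power_mult_distrib)
      next
        case 2
        hence "4 \<le> h" using k_le by simp
        thus ?thesis using mono[of 4] 2 by (simp add: power2_sum power_mult_distrib)
      next
        case 3
        thus ?thesis using mono[OF h7] h7 by (simp add: power2_sum power_mult_distrib)
      qed
    qed
  qed
qed

theorem theorem6p1:
  fixes p m q k :: nat
    and \<Gamma> \<Gamma>_plus :: "'a::finite_field rel"
  assumes "prime p" and "q = p ^ m" and "CARD('a) = q"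
    and "k dvd q - 1" and "semiprimitive_pair k p m"
  defines "\<Gamma> \<equiv> gen_paley k" and "\<Gamma>_plus \<equiv> gen_paley_sum k"
  shows "(ramanujan \<Gamma> \<longleftrightarrow> ramanujan \<Gamma>_plus) \<and>
    (ramanujan \<Gamma> \<longleftrightarrow>
      (\<Gamma> = gen_paley 2 \<and> q mod 4 = 1) \<or>
      (even m \<and>
        ((k = 3 \<and> p = 2 \<and> m \<ge> 4) \<or>
         (k = 3 \<and> p \<noteq> 2 \<and> p mod 3 = 2 \<and> m \<ge> 2) \<or>
         (k = 4 \<and> p = 3 \<and> m \<ge> 4) \<or>
         (k = 4 \<and> p \<noteq> 3 \<and> p mod 4 = 3 \<and> m \<ge> 2) \<or>
         (k = 5 \<and> p = 2 \<and> m \<ge> 8 \<and> 4 dvd m) \<or>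
         (k = 5 \<and> p \<noteq> 2 \<and> (p mod 5 = 2 \<or> p mod 5 = 3) \<and> m \<ge> 4 \<and> 4 dvd m) \<or>
         (k = 5 \<and> p mod 5 = 4 \<and> m \<ge> 2 \<and> even m)))) \<and>
    ramanujan (graph_complement \<Gamma>)"
proof (cases "k = 2")
  case True
  have q4: "q mod 4 = 1"
    using assms(2,5) True by (simp add: semiprimitive_pair_def)
  have "ramanujan \<Gamma>" "ramanujan \<Gamma>_plus" "ramanujan (graph_complement \<Gamma>)"
    using paley_2_ramanujan[OF assms(1) assms(3)[unfolded assms(2)]] q4 assms(3) True
    by (simp_all add: \<Gamma>_def \<Gamma>_plus_def)
  thus ?thesis using True q4 by (simp add: \<Gamma>_def)
next
  case False
  then obtain t where k2: "k > 2" and "even m" and t: "t > 0" "t dvd m div 2" "k dvd p ^ t + 1"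
    and kne: "k \<noteq> p ^ (m div 2) + 1"
    using assms(5) unfolding semiprimitive_pair_def by blast
  obtain s where s: "m div 2 = t * s" using t(2) by blast
  hence m: "m = 2 * t * s" using \<open>even m\<close> by (metis dvd_mult_div_cancel mult.assoc)
  have m0: "m > 0"
    using assms(2,3) CARD_finite_field_gt_1[where 'a='a] by (auto intro!: Nat.gr0I)
  have card: "CARD('a) = p ^ (2 * t * s)" using assms(2,3) m by simp
  note semi = semiprimitive_ramanujan_iff[OF assms(1) card k2 t(1,3) kne[unfolded s]]
  have ram: "ramanujan \<Gamma> \<longleftrightarrow> k \<le> 5" "ramanujan \<Gamma>_plus \<longleftrightarrow> k \<le> 5" "ramanujan (graph_complement \<Gamma>)"
    using semi by (simp_all add: \<Gamma>_def \<Gamma>_plus_def)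
  have not2: "\<not> (\<Gamma> = gen_paley 2 \<and> q mod 4 = 1)"
  proof
    assume *: "\<Gamma> = gen_paley 2 \<and> q mod 4 = 1"
    hence "q mod 4 = 1" by blast
    hence "2 dvd q - 1" by presburger
    thus False
      using gen_paley_inject[of k 2, where 'a='a] * False assms(3,4) by (simp add: \<Gamma>_def)
  qed
  have m2: "m \<ge> 2" using \<open>even m\<close> m0 by presburger
  have m4: "m \<ge> 4" if "k = p + 1"
  proof -
    have "m \<noteq> 2" using kne that by auto
    thus ?thesis using m2 \<open>even m\<close> by presburger
  qed
  have k5: "4 dvd m \<and> (p = 2 \<longrightarrow> m \<ge> 8)" if "k = 5" "even t"
  proof -
    obtain u where "t = 2 * u" using \<open>even t\<close> by blast
    hence "m = 4 * (u * s)" using m by simp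
    hence "4 dvd m" by simp
    moreover have "m \<ge> 8" if "p = 2"
    proof -
      have "m \<noteq> 4" using kne that \<open>k = 5\<close> by auto
      thus ?thesis using \<open>4 dvd m\<close> m0 by presburger
    qed
    ultimately show ?thesis by blast
  qed
  have iff: "k \<le> 5 \<longleftrightarrow>
      ((k = 3 \<and> p = 2 \<and> m \<ge> 4) \<or>
       (k = 3 \<and> p \<noteq> 2 \<and> p mod 3 = 2 \<and> m \<ge> 2) \<or>
       (k = 4 \<and> p = 3 \<and> m \<ge> 4) \<or>
       (k = 4 \<and> p \<noteq> 3 \<and> p mod 4 = 3 \<and> m \<ge> 2) \<or>
       (k = 5 \<and> p = 2 \<and> m \<ge> 8 \<and> 4 dvd m) \<or>
       (k = 5 \<and> p \<noteq> 2 \<and> (p mod 5 = 2 \<or> p mod 5 = 3) \<and> m \<ge> 4 \<and> 4 dvd m) \<or>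
       (k = 5 \<and> p mod 5 = 4 \<and> m \<ge> 2 \<and> even m))" (is "_ \<longleftrightarrow> ?cases")
  proof
    assume "k \<le> 5"
    then consider "k = 3" | "k = 4" | "k = 5" using k2 by linarith
    thus ?cases
    proof cases
      case 1
      hence "p mod 3 = 2" using mod_3_if_dvd_power_plus_1[OF t(1)] t(3) by simp
      thus ?thesis using 1 m2 m4 by auto
    next
      case 2
      hence "p mod 4 = 3" using mod_4_if_dvd_power_plus_1[OF t(1)] t(3) by simp
      thus ?thesis using 2 m2 m4 by auto
    next
      case 3
      hence "p mod 5 = 4 \<or> (p mod 5 = 2 \<or> p mod 5 = 3) \<and> even t"
        using mod_5_if_dvd_power_plus_1[OF t(1)] t(3) by simp
      thus ?thesis
      proof
        assume "p mod 5 = 4"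
        thus ?thesis using 3 m2 \<open>even m\<close> by blast
      next
        assume *: "(p mod 5 = 2 \<or> p mod 5 = 3) \<and> even t"
        hence "4 dvd m" "p = 2 \<longrightarrow> m \<ge> 8" using k5 3 by blast+
        moreover have "m \<ge> 4" using \<open>4 dvd m\<close> m0 by (simp add: dvd_imp_le)
        ultimately show ?thesis using 3 * by blast
      qed
    qed
  qed (elim disjE; simp)
  show ?thesis
    by (simp only: ram iff not2 \<open>even m\<close> simp_thms)
qed

end
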